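(* Let $\mathcal{A}$ be a homological category and let $(\mathcal{T},\mathcal{F})$ be a torsion theory in $\mathcal{A}$ satisfying condition (N) for any morphism $f\colon A\to B$ in $\mathcal{A}$, the composite $\ker(f)\circ t_{K[f]}\colon T(K[f])\to A$ is a normal monomorphism. Let $\overline{\mathbb{E}}$ be the class of all normal epimorphisms $f$ in $\mathcal{A}$ with $K[f]\in\mathcal{T}$, and $\overline{\mathbb{M}}$ the class of all morphisms $f$ in $\mathcal{A}$ with $K[f]\in\mathcal{F}$. Then $(\overline{\mathbb{E}},\overline{\mathbb{M}})$ is a stable factorisation system on $\mathcal{A}$, and $(\mathcal{T},\mathcal{F})$ is uniquely determined by $(\overline{\mathbb{E}},\overline{\mathbb{M}})$. In fact, there is a bijective correspondence between (1) the torsion theories in $\mathcal{A}$ satisfying condition (N); (2) the stable factorisation systems $(\mathbb{E},\mathbb{M})$ on $\mathcal{A}$ such that every $e\in\mathbb{E}$ is a normal epimorphism.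
   Context: A category is pointed if it has a zero object $0$; $\ker(f)\colon K[f]\to A$ denotes the kernel of $f\colon A\to B$. Normal monomorphisms are kernels of some morphism, normal epimorphisms are cokernels of some morphism. A short exact sequence is a composable pair $(k,f)$ with $k=\ker(f)$ and $f=\mathrm{coker}(k)$. A pointed category with pullbacks along split epimorphisms is protomodular if the split short five lemma holds. A homological category is a pointed protomodular regular category (regular: finitely complete with pullback-stable (regular epi)-mono factorisations). A torsion theory in a pointed category $\mathcal{A}$ is a pair $(\mathcal{T},\mathcal{F})$ of full replete subcategories such that $\mathrm{Hom}_{\mathcal{A}}(T,F)=\{0\}$ for all $T\in\mathcal{T}$, $F\in\mathcal{F}$, and every object $A$ admits a short exact sequence $0\to T(A)\xrightarrow{t_A}A\xrightarrow{\eta_A}F(A)\to 0$ with $T(A)\in\mathcal{T}$, $F(A)\in\mathcal{F}$ (unique up to isomorphism; $t_A$ is the coreflection counit and $\eta_A$ the reflection unit). For morphisms $e,m$, write $e\downarrow m$ if for all $a,b$ with $b\circ e=m\circ a$ there is a unique $d$ with $d\circ e=a$ and $m\circ d=b$. A factorisation system is a pair $(\mathbb{E},\mathbb{M})$ of classes of morphisms with $\mathbb{M}=\{m\mid e\downarrow m\ \forall e\in\mathbb{E}\}$, $\mathbb{E}=\{e\mid e\downarrow m\ \forall m\in\mathbb{M}\}$, and such that every morphism factors as $m\circ e$ with $e\in\mathbb{E}$, $m\in\mathbb{M}$. It is stable if $\mathbb{E}$ is stable under pullback. *)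

theory Defs
  imports Main
begin

section \<open>Categories\<close>

text \<open>
  Composition is written in the usual order: \<open>g \<cdot> f\<close> is ``first \<open>f\<close>, then \<open>g\<close>''.  The record fields
  are total functions, but their values are only meaningful (and only ever used) on elements of
  \<open>Obj\<close> and \<open>Arr\<close> and, for composition, on composable pairs.
\<close>

record ('o, 'm) cat =
  Obj :: "'o set"
  Arr :: "'m set"
  Dom :: "'m \<Rightarrow> 'o"
  Cod :: "'m \<Rightarrow> 'o"
  Ident :: "'o \<Rightarrow> 'm"
  Comp :: "'m \<Rightarrow> 'm \<Rightarrow> 'm"  (infixr "\<cdot>\<index>" 70)

definition Hom :: "('o, 'm) cat \<Rightarrow> 'o \<Rightarrow> 'o \<Rightarrow> 'm set" where
  "Hom C X Y = {f \<in> Arr C. Dom C f = X \<and> Cod C f = Y}"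

locale category =
  fixes C :: "('o, 'm) cat" (structure)
  assumes Dom_closed: "f \<in> Arr C \<Longrightarrow> Dom C f \<in> Obj C"
    and Cod_closed: "f \<in> Arr C \<Longrightarrow> Cod C f \<in> Obj C"
    and Ident_in_Hom: "X \<in> Obj C \<Longrightarrow> Ident C X \<in> Hom C X X"
    and Comp_in_Hom: "f \<in> Hom C X Y \<Longrightarrow> g \<in> Hom C Y Z \<Longrightarrow> g \<cdot> f \<in> Hom C X Z"
    and Comp_Ident_left: "f \<in> Hom C X Y \<Longrightarrow> Ident C Y \<cdot> f = f"
    and Comp_Ident_right: "f \<in> Hom C X Y \<Longrightarrow> f \<cdot> Ident C X = f"
    and Comp_assoc: "f \<in> Hom C W X \<Longrightarrow> g \<in> Hom C X Y \<Longrightarrow> h \<in> Hom C Y Z \<Longrightarrow>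
                       (h \<cdot> g) \<cdot> f = h \<cdot> (g \<cdot> f)"

definition iso :: "('o, 'm) cat \<Rightarrow> 'm \<Rightarrow> bool" where
  "iso C f \<longleftrightarrow> f \<in> Arr C \<and> (\<exists>g \<in> Hom C (Cod C f) (Dom C f).
     Comp C g f = Ident C (Dom C f) \<and> Comp C f g = Ident C (Cod C f))"

definition mono_arr :: "('o, 'm) cat \<Rightarrow> 'm \<Rightarrow> bool" where
  "mono_arr C m \<longleftrightarrow> m \<in> Arr C \<and>
     (\<forall>X \<in> Obj C. \<forall>x \<in> Hom C X (Dom C m). \<forall>y \<in> Hom C X (Dom C m).
        Comp C m x = Comp C m y \<longrightarrow> x = y)"

definition coequaliser :: "('o, 'm) cat \<Rightarrow> 'm \<Rightarrow> 'm \<Rightarrow> 'm \<Rightarrow> bool" where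
  "coequaliser C q f g \<longleftrightarrow>
     f \<in> Arr C \<and> g \<in> Hom C (Dom C f) (Cod C f) \<and> q \<in> Arr C \<and> Dom C q = Cod C f \<and>
     Comp C q f = Comp C q g \<and>
     (\<forall>x \<in> Arr C. Dom C x = Cod C f \<and> Comp C x f = Comp C x g \<longrightarrow>
        (\<exists>!y. y \<in> Hom C (Cod C q) (Cod C x) \<and> Comp C y q = x))"

definition regular_epi :: "('o, 'm) cat \<Rightarrow> 'm \<Rightarrow> bool" where
  "regular_epi C q \<longleftrightarrow> (\<exists>f g. coequaliser C q f g)"

text \<open>
  \<open>pullback C f g p q\<close>: the square with \<open>f \<cdot> p = g \<cdot> q\<close> is a pullback; thus \<open>q\<close> is the pullback
  of \<open>f\<close> along \<open>g\<close> (and \<open>p\<close> the pullback of \<open>g\<close> along \<open>f\<close>).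
\<close>

definition pullback :: "('o, 'm) cat \<Rightarrow> 'm \<Rightarrow> 'm \<Rightarrow> 'm \<Rightarrow> 'm \<Rightarrow> bool" where
  "pullback C f g p q \<longleftrightarrow>
     f \<in> Arr C \<and> g \<in> Arr C \<and> Cod C f = Cod C g \<and>
     p \<in> Arr C \<and> Cod C p = Dom C f \<and> q \<in> Hom C (Dom C p) (Dom C g) \<and>
     Comp C f p = Comp C g q \<and>
     (\<forall>X \<in> Obj C. \<forall>x \<in> Hom C X (Dom C f). \<forall>y \<in> Hom C X (Dom C g).
        Comp C f x = Comp C g y \<longrightarrow>
        (\<exists>!h. h \<in> Hom C X (Dom C p) \<and> Comp C p h = x \<and> Comp C q h = y))"

definition pullback_stable :: "('o, 'm) cat \<Rightarrow> 'm set \<Rightarrow> bool" where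
  "pullback_stable C E \<longleftrightarrow> (\<forall>f g p q. pullback C f g p q \<and> f \<in> E \<longrightarrow> q \<in> E)"


section \<open>Finite limits and regular categories\<close>

locale functor_between =
  dom: category J + cod: category C
  for J :: "('i, 'a) cat" and C :: "('o, 'm) cat" +
  fixes Fo :: "'i \<Rightarrow> 'o" and Fa :: "'a \<Rightarrow> 'm"
  assumes Fo_closed: "i \<in> Obj J \<Longrightarrow> Fo i \<in> Obj C"
    and Fa_in_Hom: "u \<in> Hom J i j \<Longrightarrow> Fa u \<in> Hom C (Fo i) (Fo j)"
    and Fa_Ident: "i \<in> Obj J \<Longrightarrow> Fa (Ident J i) = Ident C (Fo i)"
    and Fa_Comp: "u \<in> Hom J i j \<Longrightarrow> v \<in> Hom J j k \<Longrightarrow> Fa (Comp J v u) = Comp C (Fa v) (Fa u)"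

definition cone ::
  "('i, 'a) cat \<Rightarrow> ('o, 'm) cat \<Rightarrow> ('i \<Rightarrow> 'o) \<Rightarrow> ('a \<Rightarrow> 'm) \<Rightarrow> 'o \<Rightarrow> ('i \<Rightarrow> 'm) \<Rightarrow> bool" where
  "cone J C Fo Fa L \<pi> \<longleftrightarrow> L \<in> Obj C \<and> (\<forall>i \<in> Obj J. \<pi> i \<in> Hom C L (Fo i)) \<and>
     (\<forall>u \<in> Arr J. Comp C (Fa u) (\<pi> (Dom J u)) = \<pi> (Cod J u))"

definition limit_cone ::
  "('i, 'a) cat \<Rightarrow> ('o, 'm) cat \<Rightarrow> ('i \<Rightarrow> 'o) \<Rightarrow> ('a \<Rightarrow> 'm) \<Rightarrow> 'o \<Rightarrow> ('i \<Rightarrow> 'm) \<Rightarrow> bool" where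
  "limit_cone J C Fo Fa L \<pi> \<longleftrightarrow> cone J C Fo Fa L \<pi> \<and>
     (\<forall>X \<xi>. cone J C Fo Fa X \<xi> \<longrightarrow>
        (\<exists>!h. h \<in> Hom C X L \<and> (\<forall>i \<in> Obj J. Comp C (\<pi> i) h = \<xi> i)))"

text \<open>
  Up to isomorphism every finite category has natural numbers as objects and arrows, so
  quantifying over index categories of type \<open>(nat, nat) cat\<close> loses nothing.
\<close>

definition finitely_complete :: "('o, 'm) cat \<Rightarrow> bool" where
  "finitely_complete C \<longleftrightarrow>
     (\<forall>(J :: (nat, nat) cat) Fo Fa.
        finite (Obj J) \<and> finite (Arr J) \<and> functor_between J C Fo Fa \<longrightarrow>
        (\<exists>L \<pi>. limit_cone J C Fo Fa L \<pi>))"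

locale regular_category = category +
  assumes finitely_complete: "finitely_complete C"
    and image_factorisation:
      "f \<in> Arr C \<Longrightarrow> \<exists>e m. regular_epi C e \<and> mono_arr C m \<and> Cod C e = Dom C m \<and> f = m \<cdot> e"
    and regular_epi_stable: "pullback_stable C {e. regular_epi C e}"


section \<open>Pointed, protomodular and homological categories\<close>

definition zero_object :: "('o, 'm) cat \<Rightarrow> 'o \<Rightarrow> bool" where
  "zero_object C Z \<longleftrightarrow> Z \<in> Obj C \<and>
     (\<forall>X \<in> Obj C. (\<exists>!f. f \<in> Hom C X Z) \<and> (\<exists>!f. f \<in> Hom C Z X))"

definition zero_arr :: "('o, 'm) cat \<Rightarrow> 'm \<Rightarrow> bool" where
  "zero_arr C f \<longleftrightarrow> f \<in> Arr C \<and>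
     (\<exists>Z. zero_object C Z \<and>
        (\<exists>g \<in> Hom C (Dom C f) Z. \<exists>h \<in> Hom C Z (Cod C f). f = Comp C h g))"

locale pointed_category = category +
  assumes has_zero_object: "\<exists>Z. zero_object C Z"

definition kernel :: "('o, 'm) cat \<Rightarrow> 'm \<Rightarrow> 'm \<Rightarrow> bool" where
  "kernel C k f \<longleftrightarrow> f \<in> Arr C \<and> k \<in> Arr C \<and> Cod C k = Dom C f \<and> zero_arr C (Comp C f k) \<and>
     (\<forall>x \<in> Arr C. Cod C x = Dom C f \<and> zero_arr C (Comp C f x) \<longrightarrow>
        (\<exists>!y. y \<in> Hom C (Dom C x) (Dom C k) \<and> Comp C k y = x))"

definition cokernel :: "('o, 'm) cat \<Rightarrow> 'm \<Rightarrow> 'm \<Rightarrow> bool" where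
  "cokernel C q f \<longleftrightarrow> f \<in> Arr C \<and> q \<in> Arr C \<and> Dom C q = Cod C f \<and> zero_arr C (Comp C q f) \<and>
     (\<forall>x \<in> Arr C. Dom C x = Cod C f \<and> zero_arr C (Comp C x f) \<longrightarrow>
        (\<exists>!y. y \<in> Hom C (Cod C q) (Cod C x) \<and> Comp C y q = x))"

definition normal_mono :: "('o, 'm) cat \<Rightarrow> 'm \<Rightarrow> bool" where
  "normal_mono C k \<longleftrightarrow> (\<exists>f. kernel C k f)"

definition normal_epi :: "('o, 'm) cat \<Rightarrow> 'm \<Rightarrow> bool" where
  "normal_epi C q \<longleftrightarrow> (\<exists>f. cokernel C q f)"

definition short_exact :: "('o, 'm) cat \<Rightarrow> 'm \<Rightarrow> 'm \<Rightarrow> bool" where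
  "short_exact C k f \<longleftrightarrow> kernel C k f \<and> cokernel C f k"

text \<open>\<open>split_by C f s\<close>: the arrow \<open>f\<close> is a split epimorphism with section \<open>s\<close>.\<close>

definition split_by :: "('o, 'm) cat \<Rightarrow> 'm \<Rightarrow> 'm \<Rightarrow> bool" where
  "split_by C f s \<longleftrightarrow> f \<in> Arr C \<and> s \<in> Hom C (Cod C f) (Dom C f) \<and>
     Comp C f s = Ident C (Cod C f)"

locale protomodular_category = pointed_category +
  assumes pullbacks_along_split_epis:
      "split_by C f s \<Longrightarrow> g \<in> Arr C \<Longrightarrow> Cod C g = Cod C f \<Longrightarrow> \<exists>p q. pullback C f g p q"
    and split_short_five:
      "split_by C f s \<Longrightarrow> kernel C k f \<Longrightarrow> split_by C f' s' \<Longrightarrow> kernel C k' f' \<Longrightarrow>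
       u \<in> Hom C (Dom C k) (Dom C k') \<Longrightarrow> v \<in> Hom C (Dom C f) (Dom C f') \<Longrightarrow>
       w \<in> Hom C (Cod C f) (Cod C f') \<Longrightarrow>
       v \<cdot> k = k' \<cdot> u \<Longrightarrow> w \<cdot> f = f' \<cdot> v \<Longrightarrow> v \<cdot> s = s' \<cdot> w \<Longrightarrow>
       iso C u \<Longrightarrow> iso C w \<Longrightarrow> iso C v"

locale homological_category = protomodular_category + regular_category


section \<open>Torsion theories\<close>

text \<open>A full subcategory is represented by its set of objects.\<close>

definition replete :: "('o, 'm) cat \<Rightarrow> 'o set \<Rightarrow> bool" where
  "replete C S \<longleftrightarrow> S \<subseteq> Obj C \<and> (\<forall>f. iso C f \<and> Dom C f \<in> S \<longrightarrow> Cod C f \<in> S)"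

text \<open>
  \<open>torsion_sequence C T F t \<eta>\<close>: a short exact sequence with kernel part \<open>t\<close> and cokernel part
  \<open>\<eta>\<close>, exhibiting the torsion subobject \<open>Dom C t\<close> and the torsion-free quotient \<open>Cod C \<eta>\<close>
  of the object \<open>Cod C t = Dom C \<eta>\<close>.
\<close>

definition torsion_sequence ::
  "('o, 'm) cat \<Rightarrow> 'o set \<Rightarrow> 'o set \<Rightarrow> 'm \<Rightarrow> 'm \<Rightarrow> bool" where
  "torsion_sequence C T F t \<eta> \<longleftrightarrow> short_exact C t \<eta> \<and> Dom C t \<in> T \<and> Cod C \<eta> \<in> F"

locale torsion_theory = pointed_category +
  fixes T F :: "'a set"
  assumes replete_T: "replete C T"
    and replete_F: "replete C F"
    and Hom_T_F: "X \<in> T \<Longrightarrow> Y \<in> F \<Longrightarrow> Hom C X Y = {z. zero_arr C z \<and> Dom C z = X \<and> Cod C z = Y}"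
    and has_torsion_sequence: "A \<in> Obj C \<Longrightarrow> \<exists>t \<eta>. torsion_sequence C T F t \<eta> \<and> Cod C t = A"

text \<open>
  Kernels and torsion sequences are only determined up to isomorphism, so the condition is imposed
  for every choice of \<open>k = ker(f)\<close> and of the counit \<open>t\<close> at the object \<open>K[f] = Dom C k\<close>.
\<close>

definition condition_N :: "('o, 'm) cat \<Rightarrow> 'o set \<Rightarrow> 'o set \<Rightarrow> bool" where
  "condition_N C T F \<longleftrightarrow>
     (\<forall>f k t \<eta>. kernel C k f \<and> torsion_sequence C T F t \<eta> \<and> Cod C t = Dom C k \<longrightarrow>
        normal_mono C (Comp C k t))"


section \<open>Factorisation systems\<close>

definition orthogonal :: "('o, 'm) cat \<Rightarrow> 'm \<Rightarrow> 'm \<Rightarrow> bool" where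
  "orthogonal C e m \<longleftrightarrow>
     (\<forall>a \<in> Hom C (Dom C e) (Dom C m). \<forall>b \<in> Hom C (Cod C e) (Cod C m).
        Comp C b e = Comp C m a \<longrightarrow>
        (\<exists>!d. d \<in> Hom C (Cod C e) (Dom C m) \<and> Comp C d e = a \<and> Comp C m d = b))"

locale factorisation_system = category +
  fixes E M :: "'b set"
  assumes M_eq: "M = {m \<in> Arr C. \<forall>e \<in> E. orthogonal C e m}"
    and E_eq: "E = {e \<in> Arr C. \<forall>m \<in> M. orthogonal C e m}"
    and factorisation: "f \<in> Arr C \<Longrightarrow> \<exists>e \<in> E. \<exists>m \<in> M. Cod C e = Dom C m \<and> f = m \<cdot> e"

locale stable_factorisation_system = factorisation_system +
  assumes E_stable: "pullback_stable C E"

definition E_bar :: "('o, 'm) cat \<Rightarrow> 'o set \<Rightarrow> 'm set" where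
  "E_bar C T = {f \<in> Arr C. normal_epi C f \<and> (\<exists>k. kernel C k f \<and> Dom C k \<in> T)}"

definition M_bar :: "('o, 'm) cat \<Rightarrow> 'o set \<Rightarrow> 'm set" where
  "M_bar C F = {f \<in> Arr C. \<exists>k. kernel C k f \<and> Dom C k \<in> F}"

end

theory Submission
  imports Defs
begin

text \<open>
  In a homological category regular and normal epimorphisms coincide, since protomodularity makes a
  regular epimorphism the cokernel of its kernel. Orthogonality of the two classes comes from
  \<open>Hom(T, F) = 0\<close> applied to the comparison of kernels. To factorise \<open>f\<close>, condition (N) allows one
  to divide its domain by \<open>T(K[f])\<close>; pulling the quotient back along the kernel of the second
  factor exhibits that kernel as \<open>F(K[f])\<close>. Conversely, a stable factorisation system yields the
  objects \<open>X\<close> for which \<open>X \<rightarrow> 0\<close> lies in \<open>E\<close>, respectively in \<open>M\<close>: factorising \<open>A \<rightarrow> 0\<close> gives the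
  torsion sequence of \<open>A\<close>, and factorising \<open>f = m \<cdot> e\<close> shows that \<open>ker f \<cdot> t\<close> is the kernel of \<open>e\<close>,
  which is (N).
\<close>

section \<open>Categories, kernels and orthogonality\<close>

text \<open>Normal monomorphisms need not compose, so \<open>ker f \<cdot> t\<close> need not be the
  kernel of anything; (N) is what provides a quotient of the domain of \<open>f\<close> by
  \<open>T(K[f])\<close>. One square carries both directions. If \<open>f = m \<cdot> e\<close>,
  then \<open>ker f\<close> is the pullback of \<open>ker m\<close> along \<open>e\<close>, and the
  kernel of \<open>e\<close> is also the kernel of the induced arrow \<open>e'\<close> from
  \<open>K[f]\<close> to \<open>K[m]\<close>. Starting from a torsion theory this identifies
  \<open>K[m]\<close> with the torsion-free part of \<open>K[f]\<close>; starting from a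
  factorisation system it identifies the kernel of \<open>e\<close> with the torsion part. The
  passages are mutually inverse for formal reasons. The identity of \<open>X\<close> is a kernel of
  \<open>X \<rightarrow> 0\<close>, so the barred classes remember which objects lie in
  \<open>T\<close> and in \<open>F\<close>. Conversely, once \<open>E\<close> and \<open>M\<close>
  are contained in the barred classes, orthogonality of the latter forces equality, because each of
  \<open>E\<close> and \<open>M\<close> is the orthogonal complement of the other. Kernels and
  cokernels are relations, fixed only up to isomorphism; repleteness absorbs the choice.\<close>

context category
begin

section \<open>Composition and isomorphisms\<close>

lemma mem_Hom [simp]: "f \<in> Hom C X Y \<longleftrightarrow> f \<in> Arr C \<and> Dom C f = X \<and> Cod C f = Y"
  by (simp add: Hom_def)

lemma Obj_Dom [simp]: "f \<in> Arr C \<Longrightarrow> Dom C f \<in> Obj C"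
  by (rule Dom_closed)

lemma Obj_Cod [simp]: "f \<in> Arr C \<Longrightarrow> Cod C f \<in> Obj C"
  by (rule Cod_closed)

lemma Ident_simps [simp]:
  assumes "X \<in> Obj C"
  shows "Ident C X \<in> Arr C" "Dom C (Ident C X) = X" "Cod C (Ident C X) = X"
  using Ident_in_Hom[OF assms] by auto

lemma Comp_simps [simp]:
  assumes "f \<in> Arr C" "g \<in> Arr C" "Dom C g = Cod C f"
  shows "g \<cdot> f \<in> Arr C" "Dom C (g \<cdot> f) = Dom C f" "Cod C (g \<cdot> f) = Cod C g"
  using Comp_in_Hom[of f "Dom C f" "Cod C f" g "Cod C g"] assms by auto

lemma Ident_Comp [simp]: "f \<in> Arr C \<Longrightarrow> Cod C f = Y \<Longrightarrow> Ident C Y \<cdot> f = f"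
  using Comp_Ident_left by auto

lemma Comp_Ident [simp]: "f \<in> Arr C \<Longrightarrow> Dom C f = X \<Longrightarrow> f \<cdot> Ident C X = f"
  using Comp_Ident_right by auto

lemma assoc:
  "f \<in> Arr C \<Longrightarrow> g \<in> Arr C \<Longrightarrow> h \<in> Arr C \<Longrightarrow> Dom C g = Cod C f \<Longrightarrow> Dom C h = Cod C g
    \<Longrightarrow> (h \<cdot> g) \<cdot> f = h \<cdot> (g \<cdot> f)"
  using Comp_assoc[of f "Dom C f" "Cod C f" g "Cod C g" h "Cod C h"] by simp

lemma Comp_cancel:
  assumes "j \<cdot> i = Ident C (Dom C i)" "i \<in> Arr C" "j \<in> Arr C" "x \<in> Arr C"
    "Dom C j = Cod C i" "Cod C x = Dom C i"
  shows "j \<cdot> (i \<cdot> x) = x"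
  using assms assoc[of x i j] by simp

lemma isoI:
  assumes "f \<in> Arr C" "g \<in> Arr C" "Dom C g = Cod C f" "Cod C g = Dom C f"
    and "g \<cdot> f = Ident C (Dom C f)" "f \<cdot> g = Ident C (Cod C f)"
  shows "iso C f"
  using assms unfolding iso_def by auto

lemma isoE:
  assumes "iso C f"
  obtains g where "f \<in> Arr C" "g \<in> Arr C" "Dom C g = Cod C f" "Cod C g = Dom C f"
    "g \<cdot> f = Ident C (Dom C f)" "f \<cdot> g = Ident C (Cod C f)"
  using assms unfolding iso_def by auto

lemma iso_Ident: "X \<in> Obj C \<Longrightarrow> iso C (Ident C X)"
  by (rule isoI[where g = "Ident C X"]) auto

lemma iso_inverse:
  assumes "iso C f"
  obtains g where "iso C g" "Dom C g = Cod C f" "Cod C g = Dom C f"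
    "g \<cdot> f = Ident C (Dom C f)" "f \<cdot> g = Ident C (Cod C f)"
  using assms by (elim isoE) (metis isoI)

subsection \<open>Pullbacks\<close>

lemma pullbackD:
  assumes "pullback C f g p q"
  shows "f \<in> Arr C" "g \<in> Arr C" "Cod C f = Cod C g" "p \<in> Arr C" "q \<in> Arr C"
    "Cod C p = Dom C f" "Cod C q = Dom C g" "Dom C q = Dom C p" "f \<cdot> p = g \<cdot> q"
  using assms unfolding pullback_def by auto

lemma pullback_lift:
  assumes "pullback C f g p q" "x \<in> Arr C" "y \<in> Arr C" "Dom C x = Dom C y"
    "Cod C x = Dom C f" "Cod C y = Dom C g" "f \<cdot> x = g \<cdot> y"
  shows "\<exists>h. h \<in> Arr C \<and> Dom C h = Dom C x \<and> Cod C h = Dom C p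
    \<and> p \<cdot> h = x \<and> q \<cdot> h = y"
proof -
  have "\<exists>!h. h \<in> Hom C (Dom C x) (Dom C p) \<and> p \<cdot> h = x \<and> q \<cdot> h = y"
    using assms unfolding pullback_def by auto
  then show ?thesis by auto
qed

lemma pullback_unique:
  assumes P: "pullback C f g p q" and x: "x \<in> Arr C" and y: "y \<in> Arr C"
    and d: "Dom C x = Dom C y" "Cod C x = Dom C p" "Cod C y = Dom C p"
    and e: "p \<cdot> x = p \<cdot> y" "q \<cdot> x = q \<cdot> y"
  shows "x = y"
proof -
  note D = pullbackD[OF P]
  have "f \<cdot> (p \<cdot> y) = g \<cdot> (q \<cdot> y)"
    using D y d by (simp flip: assoc)
  then have "\<exists>!h. h \<in> Hom C (Dom C x) (Dom C p) \<and> p \<cdot> h = p \<cdot> y \<and> q \<cdot> h = q \<cdot> y"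
    using P D x y d unfolding pullback_def by auto
  then show ?thesis using x y d e by auto
qed

lemma pullbackI:
  assumes "f \<in> Arr C" "g \<in> Arr C" "Cod C f = Cod C g" "p \<in> Arr C" "q \<in> Arr C"
    "Cod C p = Dom C f" "Cod C q = Dom C g" "Dom C q = Dom C p" "f \<cdot> p = g \<cdot> q"
    and lift: "\<And>x y. x \<in> Arr C \<Longrightarrow> y \<in> Arr C \<Longrightarrow> Dom C x = Dom C y \<Longrightarrow>
      Cod C x = Dom C f \<Longrightarrow> Cod C y = Dom C g \<Longrightarrow> f \<cdot> x = g \<cdot> y \<Longrightarrow>
      \<exists>h. h \<in> Arr C \<and> Dom C h = Dom C x \<and> Cod C h = Dom C p \<and> p \<cdot> h = x \<and> q \<cdot> h = y"
    and unique: "\<And>x y. x \<in> Arr C \<Longrightarrow> y \<in> Arr C \<Longrightarrow> Dom C x = Dom C y \<Longrightarrow>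
      Cod C x = Dom C p \<Longrightarrow> Cod C y = Dom C p \<Longrightarrow> p \<cdot> x = p \<cdot> y \<Longrightarrow> q \<cdot> x = q \<cdot> y \<Longrightarrow> x = y"
  shows "pullback C f g p q"
proof -
  have "\<exists>!h. h \<in> Hom C X (Dom C p) \<and> p \<cdot> h = x \<and> q \<cdot> h = y"
    if "x \<in> Hom C X (Dom C f)" "y \<in> Hom C X (Dom C g)" "f \<cdot> x = g \<cdot> y" for X x y
  proof (rule ex_ex1I)
    show "\<exists>h. h \<in> Hom C X (Dom C p) \<and> p \<cdot> h = x \<and> q \<cdot> h = y"
      using lift[of x y] that by auto
  qed (auto intro: unique)
  then show ?thesis using assms(1-9) unfolding pullback_def by (intro conjI ballI impI) auto
qed

text \<open>Presents precomposition with an isomorphism as a pullback along an identity. Every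
  pullback-stable class is therefore closed under it, which is how repleteness is obtained
  later.\<close>

lemma pullback_of_iso:
  assumes x: "x \<in> Arr C" and i: "iso C i" and d: "Dom C x = Cod C i"
  shows "pullback C x (Ident C (Cod C x)) i (x \<cdot> i)"
proof -
  obtain j where j: "i \<in> Arr C" "j \<in> Arr C" "Dom C j = Cod C i" "Cod C j = Dom C i"
    "j \<cdot> i = Ident C (Dom C i)" "i \<cdot> j = Ident C (Cod C i)"
    using i by (rule isoE)
  show ?thesis
  proof (rule pullbackI)
    fix u v
    assume u: "u \<in> Arr C" "v \<in> Arr C" "Dom C u = Dom C v" "Cod C u = Dom C x"
      "Cod C v = Dom C (Ident C (Cod C x))" "x \<cdot> u = Ident C (Cod C x) \<cdot> v"
    have "i \<cdot> (j \<cdot> u) = u"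
      using j u d by (simp flip: assoc)
    moreover from this have "(x \<cdot> i) \<cdot> (j \<cdot> u) = v"
      using j u d x by (simp add: assoc)
    ultimately show "\<exists>h. h \<in> Arr C \<and> Dom C h = Dom C u \<and> Cod C h = Dom C i \<and> i \<cdot> h = u
        \<and> (x \<cdot> i) \<cdot> h = v"
      using j u d by (intro exI[of _ "j \<cdot> u"]) simp
  next
    fix u v
    assume u: "u \<in> Arr C" "v \<in> Arr C" "Dom C u = Dom C v" "Cod C u = Dom C i" "Cod C v = Dom C i"
      "i \<cdot> u = i \<cdot> v"
    have "j \<cdot> (i \<cdot> u) = j \<cdot> (i \<cdot> v)" using u by simp
    then have "(j \<cdot> i) \<cdot> u = (j \<cdot> i) \<cdot> v" using u(1-5) j(1-4) by (simp add: assoc)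
    then show "u = v" using u(1-5) j by simp
  qed (use x j d in simp_all)
qed

subsection \<open>Zero morphisms, kernels and cokernels\<close>

lemma zero_arrI:
  assumes "zero_object C Z" "u \<in> Arr C" "v \<in> Arr C" "Cod C u = Z" "Dom C v = Z"
  shows "zero_arr C (v \<cdot> u)"
proof -
  have "u \<in> Hom C (Dom C (v \<cdot> u)) Z" "v \<in> Hom C Z (Cod C (v \<cdot> u))" "v \<cdot> u \<in> Arr C"
    using assms by auto
  then show ?thesis using assms(1) unfolding zero_arr_def by blast
qed

lemma zero_arrE:
  assumes "zero_arr C f"
  obtains Z u v where "zero_object C Z" "u \<in> Arr C" "v \<in> Arr C" "Cod C u = Z" "Dom C v = Z"
    "f = v \<cdot> u"
  using assms unfolding zero_arr_def Hom_def by blast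

lemma zero_arr_Arr: "zero_arr C f \<Longrightarrow> f \<in> Arr C"
  by (simp add: zero_arr_def)

lemma zero_arr_Comp_left:
  assumes "zero_arr C f" "g \<in> Arr C" "Dom C g = Cod C f"
  shows "zero_arr C (g \<cdot> f)"
proof -
  obtain Z u v where f: "zero_object C Z" "u \<in> Arr C" "v \<in> Arr C" "Cod C u = Z" "Dom C v = Z"
    "f = v \<cdot> u"
    using assms(1) by (rule zero_arrE)
  have "zero_arr C ((g \<cdot> v) \<cdot> u)" using f assms by (intro zero_arrI[of Z]) auto
  then show ?thesis using f assms by (simp add: assoc)
qed

lemma zero_arr_Comp_right:
  assumes "zero_arr C f" "g \<in> Arr C" "Cod C g = Dom C f"
  shows "zero_arr C (f \<cdot> g)"
proof -
  obtain Z u v where f: "zero_object C Z" "u \<in> Arr C" "v \<in> Arr C" "Cod C u = Z" "Dom C v = Z"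
    "f = v \<cdot> u"
    using assms(1) by (rule zero_arrE)
  have "zero_arr C (v \<cdot> (u \<cdot> g))" using f assms by (intro zero_arrI[of Z]) auto
  then show ?thesis using f assms by (simp add: assoc)
qed

lemma zero_object_to:
  assumes "zero_object C Z" "X \<in> Obj C"
  shows "\<exists>f. f \<in> Arr C \<and> Dom C f = X \<and> Cod C f = Z
    \<and> zero_arr C f"
proof -
  obtain f where f: "f \<in> Arr C" "Dom C f = X" "Cod C f = Z"
    using assms unfolding zero_object_def mem_Hom by blast
  have "Z \<in> Obj C" using assms(1) unfolding zero_object_def by blast
  then have "zero_arr C (Ident C Z \<cdot> f)"
    using f assms(1) \<open>Z \<in> Obj C\<close> by (intro zero_arrI[of Z]) simp_all
  then have "zero_arr C f" using f by simp
  with f show ?thesis by blast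
qed

lemma zero_object_from:
  assumes "zero_object C Z" "X \<in> Obj C"
  shows "\<exists>f. f \<in> Arr C \<and> Dom C f = Z \<and> Cod C f = X
    \<and> zero_arr C f"
proof -
  obtain f where f: "f \<in> Arr C" "Dom C f = Z" "Cod C f = X"
    using assms unfolding zero_object_def mem_Hom by blast
  have "Z \<in> Obj C" using assms(1) unfolding zero_object_def by blast
  then have "zero_arr C (f \<cdot> Ident C Z)"
    using f assms(1) \<open>Z \<in> Obj C\<close> by (intro zero_arrI[of Z]) simp_all
  then have "zero_arr C f" using f by simp
  with f show ?thesis by blast
qed

lemma zero_object_to_unique:
  assumes "zero_object C Z" "f \<in> Arr C" "g \<in> Arr C" "Dom C f = Dom C g" "Cod C f = Z" "Cod C g = Z"
  shows "f = g"
proof -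
  have "\<exists>!h. h \<in> Hom C (Dom C f) Z"
    using assms(1) Obj_Dom[OF assms(2)] unfolding zero_object_def by blast
  moreover have "f \<in> Hom C (Dom C f) Z" "g \<in> Hom C (Dom C f) Z" using assms by simp_all
  ultimately show ?thesis by blast
qed

lemma zero_object_from_unique:
  assumes "zero_object C Z" "f \<in> Arr C" "g \<in> Arr C" "Cod C f = Cod C g" "Dom C f = Z" "Dom C g = Z"
  shows "f = g"
proof -
  have "\<exists>!h. h \<in> Hom C Z (Cod C f)"
    using assms(1) Obj_Cod[OF assms(2)] unfolding zero_object_def by blast
  moreover have "f \<in> Hom C Z (Cod C f)" "g \<in> Hom C Z (Cod C f)" using assms by simp_all
  ultimately show ?thesis by blast
qed

lemma zero_arr_to_zero_object:
  assumes "zero_object C Z" "f \<in> Arr C" "Cod C f = Z"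
  shows "zero_arr C f"
proof -
  obtain g where "g \<in> Arr C" "Dom C g = Dom C f" "Cod C g = Z" "zero_arr C g"
    using zero_object_to[OF assms(1) Obj_Dom[OF assms(2)]] by blast
  moreover from this have "f = g"
    using assms by (intro zero_object_to_unique[of Z]) simp_all
  ultimately show ?thesis by simp
qed

text \<open>\<open>zero_arr\<close> leaves the zero object open, so the two arrows may factor
  through different ones; the arrow \<open>w\<close> between these objects matches the two
  factorisations.\<close>

lemma zero_arr_unique:
  assumes "zero_arr C f" "zero_arr C g" "Dom C f = Dom C g" "Cod C f = Cod C g"
  shows "f = g"
proof -
  obtain Z u v where f: "zero_object C Z" "u \<in> Arr C" "v \<in> Arr C" "Cod C u = Z" "Dom C v = Z"
    "f = v \<cdot> u"
    using assms(1) by (rule zero_arrE)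
  obtain Z' u' v' where g: "zero_object C Z'" "u' \<in> Arr C" "v' \<in> Arr C" "Cod C u' = Z'"
    "Dom C v' = Z'" "g = v' \<cdot> u'"
    using assms(2) by (rule zero_arrE)
  have "Z' \<in> Obj C" using g by auto
  then obtain w where w: "w \<in> Arr C" "Dom C w = Z" "Cod C w = Z'"
    using zero_object_from[OF f(1)] by blast
  have "w \<cdot> u = u'"
    using f g w assms(3) by (intro zero_object_to_unique[OF g(1)]) simp_all
  moreover have "v' \<cdot> w = v"
    using f g w assms(4) by (intro zero_object_from_unique[OF f(1)]) simp_all
  moreover have "(v' \<cdot> w) \<cdot> u = v' \<cdot> (w \<cdot> u)"
    using f g w by (intro assoc) simp_all
  ultimately show ?thesis using f(6) g(6) by simp
qed

section \<open>Kernels and cokernels\<close>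

lemma kernelD:
  assumes "kernel C k f"
  shows "f \<in> Arr C" "k \<in> Arr C" "Cod C k = Dom C f" "zero_arr C (f \<cdot> k)"
  using assms unfolding kernel_def by auto

lemma kernel_lift:
  assumes "kernel C k f" "x \<in> Arr C" "Cod C x = Dom C f" "zero_arr C (f \<cdot> x)"
  shows "\<exists>y. y \<in> Arr C \<and> Dom C y = Dom C x \<and> Cod C y = Dom C k
    \<and> k \<cdot> y = x"
proof -
  have "\<exists>!y. y \<in> Hom C (Dom C x) (Dom C k) \<and> k \<cdot> y = x"
    using assms unfolding kernel_def by blast
  then show ?thesis by auto
qed

lemma kernel_cancel:
  assumes k: "kernel C k f" and x: "x \<in> Arr C" "y \<in> Arr C" "Dom C x = Dom C y"
    "Cod C x = Dom C k" "Cod C y = Dom C k" "k \<cdot> x = k \<cdot> y"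
  shows "x = y"
proof -
  note D = kernelD[OF k]
  have "zero_arr C (f \<cdot> (k \<cdot> y))"
    using zero_arr_Comp_right[OF D(4), of y] D x by (simp add: assoc)
  moreover have "k \<cdot> y \<in> Arr C" "Cod C (k \<cdot> y) = Dom C f" "Dom C (k \<cdot> y) = Dom C x"
    using D x by simp_all
  ultimately have "\<exists>!z. z \<in> Hom C (Dom C x) (Dom C k) \<and> k \<cdot> z = k \<cdot> y"
    using k unfolding kernel_def by metis
  moreover have "x \<in> Hom C (Dom C x) (Dom C k)" "y \<in> Hom C (Dom C x) (Dom C k)"
    using x by simp_all
  ultimately show ?thesis using x(6) by blast
qed

lemma kernelI:
  assumes "f \<in> Arr C" "k \<in> Arr C" "Cod C k = Dom C f" "zero_arr C (f \<cdot> k)"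
    and lift: "\<And>x. x \<in> Arr C \<Longrightarrow> Cod C x = Dom C f \<Longrightarrow> zero_arr C (f \<cdot> x) \<Longrightarrow>
      \<exists>y. y \<in> Arr C \<and> Dom C y = Dom C x \<and> Cod C y = Dom C k \<and> k \<cdot> y = x"
    and cancel: "\<And>x y. x \<in> Arr C \<Longrightarrow> y \<in> Arr C \<Longrightarrow> Dom C x = Dom C y \<Longrightarrow>
      Cod C x = Dom C k \<Longrightarrow> Cod C y = Dom C k \<Longrightarrow> k \<cdot> x = k \<cdot> y \<Longrightarrow> x = y"
  shows "kernel C k f"
proof -
  have "\<exists>!y. y \<in> Hom C (Dom C x) (Dom C k) \<and> k \<cdot> y = x"
    if "x \<in> Arr C" "Cod C x = Dom C f" "zero_arr C (f \<cdot> x)" for x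
  proof (rule ex_ex1I)
    show "\<exists>y. y \<in> Hom C (Dom C x) (Dom C k) \<and> k \<cdot> y = x"
      using lift[of x] that by auto
  qed (auto intro: cancel)
  then show ?thesis using assms(1-4) unfolding kernel_def by blast
qed

lemma cokernelD:
  assumes "cokernel C q f"
  shows "f \<in> Arr C" "q \<in> Arr C" "Dom C q = Cod C f" "zero_arr C (q \<cdot> f)"
  using assms unfolding cokernel_def by auto

lemma cokernel_lift:
  assumes "cokernel C q f" "x \<in> Arr C" "Dom C x = Cod C f" "zero_arr C (x \<cdot> f)"
  shows "\<exists>y. y \<in> Arr C \<and> Dom C y = Cod C q \<and> Cod C y = Cod C x
    \<and> y \<cdot> q = x"
proof -
  have "\<exists>!y. y \<in> Hom C (Cod C q) (Cod C x) \<and> y \<cdot> q = x"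
    using assms unfolding cokernel_def by blast
  then show ?thesis by auto
qed

lemma cokernel_cancel:
  assumes k: "cokernel C q f" and x: "x \<in> Arr C" "y \<in> Arr C" "Cod C x = Cod C y"
    "Dom C x = Cod C q" "Dom C y = Cod C q" "x \<cdot> q = y \<cdot> q"
  shows "x = y"
proof -
  note D = cokernelD[OF k]
  have "zero_arr C ((y \<cdot> q) \<cdot> f)"
    using zero_arr_Comp_left[OF D(4), of y] D x by (simp add: assoc)
  moreover have "y \<cdot> q \<in> Arr C" "Dom C (y \<cdot> q) = Cod C f" "Cod C (y \<cdot> q) = Cod C x"
    using D x by simp_all
  ultimately have "\<exists>!z. z \<in> Hom C (Cod C q) (Cod C x) \<and> z \<cdot> q = y \<cdot> q"
    using k unfolding cokernel_def by metis
  moreover have "x \<in> Hom C (Cod C q) (Cod C x)" "y \<in> Hom C (Cod C q) (Cod C x)"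
    using x by simp_all
  ultimately show ?thesis using x(6) by blast
qed

lemma cokernelI:
  assumes "f \<in> Arr C" "q \<in> Arr C" "Dom C q = Cod C f" "zero_arr C (q \<cdot> f)"
    and lift: "\<And>x. x \<in> Arr C \<Longrightarrow> Dom C x = Cod C f \<Longrightarrow> zero_arr C (x \<cdot> f) \<Longrightarrow>
      \<exists>y. y \<in> Arr C \<and> Dom C y = Cod C q \<and> Cod C y = Cod C x \<and> y \<cdot> q = x"
    and cancel: "\<And>x y. x \<in> Arr C \<Longrightarrow> y \<in> Arr C \<Longrightarrow> Cod C x = Cod C y \<Longrightarrow>
      Dom C x = Cod C q \<Longrightarrow> Dom C y = Cod C q \<Longrightarrow> x \<cdot> q = y \<cdot> q \<Longrightarrow> x = y"
  shows "cokernel C q f"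
proof -
  have "\<exists>!y. y \<in> Hom C (Cod C q) (Cod C x) \<and> y \<cdot> q = x"
    if "x \<in> Arr C" "Dom C x = Cod C f" "zero_arr C (x \<cdot> f)" for x
  proof (rule ex_ex1I)
    show "\<exists>y. y \<in> Hom C (Cod C q) (Cod C x) \<and> y \<cdot> q = x"
      using lift[of x] that by auto
  qed (auto intro: cancel)
  then show ?thesis using assms(1-4) unfolding cokernel_def by blast
qed

lemma normal_epi_cancel:
  assumes "normal_epi C q" "x \<in> Arr C" "y \<in> Arr C" "Cod C x = Cod C y"
    "Dom C x = Cod C q" "Dom C y = Cod C q" "x \<cdot> q = y \<cdot> q"
  shows "x = y"
  using assms cokernel_cancel unfolding normal_epi_def by blast

text \<open>Both \<open>m \<cdot> f\<close> and \<open>m\<close> after a parallel zero arrow are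
  zero, hence equal, and \<open>m\<close> cancels. Monicity enters as a bare cancellation rule so
  that kernels and \<open>mono_arr\<close> can both supply it.\<close>

lemma zero_arr_reflect:
  assumes f: "f \<in> Arr C" "m \<in> Arr C" "Dom C m = Cod C f" and z: "zero_arr C (m \<cdot> f)"
    and cancel: "\<And>x y. x \<in> Arr C \<Longrightarrow> y \<in> Arr C \<Longrightarrow> Dom C x = Dom C y \<Longrightarrow>
      Cod C x = Dom C m \<Longrightarrow> Cod C y = Dom C m \<Longrightarrow> m \<cdot> x = m \<cdot> y \<Longrightarrow> x = y"
  shows "zero_arr C f"
proof -
  obtain Z where Z: "zero_object C Z" using z by (rule zero_arrE)
  obtain u where u: "u \<in> Arr C" "Dom C u = Dom C f" "Cod C u = Z" "zero_arr C u"
    using zero_object_to[OF Z, of "Dom C f"] f by auto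
  obtain v where v: "v \<in> Arr C" "Dom C v = Z" "Cod C v = Cod C f" "zero_arr C v"
    using zero_object_from[OF Z, of "Cod C f"] f by auto
  have vu: "zero_arr C (v \<cdot> u)" using u v by (intro zero_arr_Comp_left) auto
  have "zero_arr C (m \<cdot> (v \<cdot> u))" using vu u v f by (intro zero_arr_Comp_left) auto
  with z have "m \<cdot> f = m \<cdot> (v \<cdot> u)" by (rule zero_arr_unique) (use u v f in auto)
  from _ _ _ _ _ this have "f = v \<cdot> u" by (rule cancel) (use f u v in auto)
  then show ?thesis using vu by simp
qed

lemma kernel_iso_of_zero_arr:
  assumes k: "kernel C k f" and f: "zero_arr C f"
  shows "iso C k"
proof -
  note D = kernelD[OF k]
  have "zero_arr C (f \<cdot> Ident C (Dom C f))" using D f by simp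
  then obtain y where y: "y \<in> Arr C" "Dom C y = Dom C f" "Cod C y = Dom C k"
      "k \<cdot> y = Ident C (Dom C f)"
    using kernel_lift[OF k, of "Ident C (Dom C f)"] D by auto
  have "y \<cdot> k = Ident C (Dom C k)"
    by (rule kernel_cancel[OF k]) (use y D in \<open>simp_all flip: assoc\<close>)
  then show ?thesis using D y by (intro isoI[where g = y]) auto
qed

lemma kernel_Ident_of_zero_arr:
  assumes "zero_arr C f"
  shows "kernel C (Ident C (Dom C f)) f"
  using assms zero_arr_Arr[OF assms] by (intro kernelI) auto

lemma kernel_Comp_iso:
  assumes k: "kernel C k f" and i: "iso C i" "Cod C i = Dom C k"
  shows "kernel C (k \<cdot> i) f"
proof -
  note D = kernelD[OF k]
  obtain j where j: "i \<in> Arr C" "j \<in> Arr C" "Dom C j = Cod C i" "Cod C j = Dom C i"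
    "j \<cdot> i = Ident C (Dom C i)" "i \<cdot> j = Ident C (Cod C i)"
    using i(1) by (rule isoE)
  show ?thesis
  proof (rule kernelI)
    show "zero_arr C (f \<cdot> (k \<cdot> i))"
      using zero_arr_Comp_right[OF D(4), of i] D j i by (simp add: assoc)
  next
    fix x assume "x \<in> Arr C" "Cod C x = Dom C f" "zero_arr C (f \<cdot> x)"
    then obtain y where y: "y \<in> Arr C" "Dom C y = Dom C x" "Cod C y = Dom C k" "k \<cdot> y = x"
      using kernel_lift[OF k] by metis
    have "i \<cdot> (j \<cdot> y) = y" using y j i by (simp flip: assoc)
    then show "\<exists>y. y \<in> Arr C \<and> Dom C y = Dom C x \<and> Cod C y = Dom C (k \<cdot> i) \<and> (k \<cdot> i) \<cdot> y = x"
      using y j i D by (intro exI[of _ "j \<cdot> y"]) (simp add: assoc)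
  next
    fix x y
    assume x: "x \<in> Arr C" "y \<in> Arr C" "Dom C x = Dom C y" "Cod C x = Dom C (k \<cdot> i)"
      "Cod C y = Dom C (k \<cdot> i)" "(k \<cdot> i) \<cdot> x = (k \<cdot> i) \<cdot> y"
    have "i \<cdot> x = i \<cdot> y"
      by (rule kernel_cancel[OF k]) (use x j i D in \<open>simp_all add: assoc\<close>)
    then have "j \<cdot> (i \<cdot> x) = j \<cdot> (i \<cdot> y)" by simp
    then show "x = y" using x j i D by (simp flip: assoc)
  qed (use D j i in auto)
qed

text \<open>Composing \<open>k\<close> with the inverse of \<open>i\<close> leaves its domain
  untouched, so the kernel object is literally the same and stays in any class of objects.\<close>

lemma kernel_of_Comp_iso:
  assumes k: "kernel C k f" and i: "iso C i" and d: "Cod C i = Dom C f"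
  shows "\<exists>k'. kernel C k' (f \<cdot> i) \<and> Dom C k' = Dom C k"
proof -
  note D = kernelD[OF k]
  obtain j where j: "i \<in> Arr C" "j \<in> Arr C" "Dom C j = Cod C i" "Cod C j = Dom C i"
    "j \<cdot> i = Ident C (Dom C i)" "i \<cdot> j = Ident C (Cod C i)"
    using i(1) by (rule isoE)
  have ijk: "i \<cdot> (j \<cdot> k) = k" using D j d by (simp flip: assoc)
  have jix: "j \<cdot> (i \<cdot> x) = x" if "x \<in> Arr C" "Cod C x = Dom C i" for x
    using that j by (simp flip: assoc)
  have "kernel C (j \<cdot> k) (f \<cdot> i)"
  proof (rule kernelI)
    show "zero_arr C ((f \<cdot> i) \<cdot> (j \<cdot> k))"
      using D j d ijk by (simp add: assoc)
  next
    fix x assume x: "x \<in> Arr C" "Cod C x = Dom C (f \<cdot> i)" "zero_arr C ((f \<cdot> i) \<cdot> x)"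
    have "zero_arr C (f \<cdot> (i \<cdot> x))" using x D j d by (simp add: assoc)
    then obtain y where y: "y \<in> Arr C" "Dom C y = Dom C x" "Cod C y = Dom C k" "k \<cdot> y = i \<cdot> x"
      using kernel_lift[OF k, of "i \<cdot> x"] x D j d by auto
    have "(j \<cdot> k) \<cdot> y = x" using y D j d x jix[of x] by (simp add: assoc)
    then show "\<exists>y. y \<in> Arr C \<and> Dom C y = Dom C x \<and> Cod C y = Dom C (j \<cdot> k) \<and> (j \<cdot> k) \<cdot> y = x"
      using y D j d by (intro exI[of _ y]) simp
  next
    fix x y
    assume x: "x \<in> Arr C" "y \<in> Arr C" "Dom C x = Dom C y" "Cod C x = Dom C (j \<cdot> k)"
      "Cod C y = Dom C (j \<cdot> k)" "(j \<cdot> k) \<cdot> x = (j \<cdot> k) \<cdot> y"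
    have "i \<cdot> ((j \<cdot> k) \<cdot> x) = i \<cdot> ((j \<cdot> k) \<cdot> y)" using x by simp
    then have "(i \<cdot> (j \<cdot> k)) \<cdot> x = (i \<cdot> (j \<cdot> k)) \<cdot> y"
      using x j D d by (simp add: assoc)
    then show "x = y" using kernel_cancel[OF k] x ijk D j d by simp
  qed (use D j d in auto)
  then show ?thesis using D j d by (intro exI[of _ "j \<cdot> k"]) simp
qed

lemma kernel_iso_Comp:
  assumes k: "kernel C k f" and i: "iso C i" and d: "Dom C i = Cod C f"
  shows "kernel C k (i \<cdot> f)"
proof -
  note D = kernelD[OF k]
  obtain j where j: "i \<in> Arr C" "j \<in> Arr C" "Dom C j = Cod C i" "Cod C j = Dom C i"
    "j \<cdot> i = Ident C (Dom C i)" "i \<cdot> j = Ident C (Cod C i)"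
    using i(1) by (rule isoE)
  show ?thesis
  proof (rule kernelI)
    show "zero_arr C ((i \<cdot> f) \<cdot> k)"
      using D j d zero_arr_Comp_left[OF D(4), of i] by (simp add: assoc)
  next
    fix x assume x: "x \<in> Arr C" "Cod C x = Dom C (i \<cdot> f)" "zero_arr C ((i \<cdot> f) \<cdot> x)"
    have "j \<cdot> ((i \<cdot> f) \<cdot> x) = f \<cdot> x"
      using x D j d by (simp add: assoc Comp_cancel)
    then have "zero_arr C (f \<cdot> x)"
      using zero_arr_Comp_left[OF x(3), of j] x D j d by simp
    then show "\<exists>y. y \<in> Arr C \<and> Dom C y = Dom C x \<and> Cod C y = Dom C k \<and> k \<cdot> y = x"
      using kernel_lift[OF k, of x] x D j d by auto
  qed (use D j d kernel_cancel[OF k] in auto)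
qed

lemma cokernel_iso_Comp:
  assumes q: "cokernel C q f" and i: "iso C i" and d: "Dom C i = Cod C q"
  shows "cokernel C (i \<cdot> q) f"
proof -
  note D = cokernelD[OF q]
  obtain j where j: "i \<in> Arr C" "j \<in> Arr C" "Dom C j = Cod C i" "Cod C j = Dom C i"
    "j \<cdot> i = Ident C (Dom C i)" "i \<cdot> j = Ident C (Cod C i)"
    using i(1) by (rule isoE)
  show ?thesis
  proof (rule cokernelI)
    show "zero_arr C ((i \<cdot> q) \<cdot> f)"
      using D j d zero_arr_Comp_left[OF D(4), of i] by (simp add: assoc)
  next
    fix x assume x: "x \<in> Arr C" "Dom C x = Cod C f" "zero_arr C (x \<cdot> f)"
    obtain y where y: "y \<in> Arr C" "Dom C y = Cod C q" "Cod C y = Cod C x" "y \<cdot> q = x"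
      using cokernel_lift[OF q x] by blast
    have "(y \<cdot> j) \<cdot> (i \<cdot> q) = x"
      using y j d D by (simp add: assoc Comp_cancel)
    then show "\<exists>y. y \<in> Arr C \<and> Dom C y = Cod C (i \<cdot> q) \<and> Cod C y = Cod C x \<and> y \<cdot> (i \<cdot> q) = x"
      using y j d D by (intro exI[of _ "y \<cdot> j"]) simp
  next
    fix x y
    assume x: "x \<in> Arr C" "y \<in> Arr C" "Cod C x = Cod C y" "Dom C x = Cod C (i \<cdot> q)"
      "Dom C y = Cod C (i \<cdot> q)" "x \<cdot> (i \<cdot> q) = y \<cdot> (i \<cdot> q)"
    have "x \<cdot> i = y \<cdot> i"
      by (rule cokernel_cancel[OF q]) (use x j d D in \<open>simp_all add: assoc\<close>)
    then have "(x \<cdot> i) \<cdot> j = (y \<cdot> i) \<cdot> j" by simp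
    then show "x = y" using x j d D by (simp add: assoc)
  qed (use D j d in auto)
qed

lemma cokernels_iso:
  assumes p: "cokernel C p f" and q: "cokernel C q f"
  obtains i where "iso C i" "Dom C i = Cod C p" "Cod C i = Cod C q" "i \<cdot> p = q"
proof -
  note P = cokernelD[OF p] and Q = cokernelD[OF q]
  obtain i where i: "i \<in> Arr C" "Dom C i = Cod C p" "Cod C i = Cod C q" "i \<cdot> p = q"
    using cokernel_lift[OF p Q(2-4)] by blast
  obtain j where j: "j \<in> Arr C" "Dom C j = Cod C q" "Cod C j = Cod C p" "j \<cdot> q = p"
    using cokernel_lift[OF q P(2-4)] by blast
  have "j \<cdot> i = Ident C (Dom C i)"
    by (rule cokernel_cancel[OF p]) (use i j P in \<open>simp_all add: assoc\<close>)
  moreover have "i \<cdot> j = Ident C (Cod C i)"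
    by (rule cokernel_cancel[OF q]) (use i j Q in \<open>simp_all add: assoc\<close>)
  ultimately show thesis using i j that by (metis isoI)
qed

section \<open>Kernels under monomorphisms and pullbacks\<close>

lemma mono_arr_cancel:
  assumes "mono_arr C m" "x \<in> Arr C" "y \<in> Arr C" "Dom C x = Dom C y" "Cod C x = Dom C m"
    "Cod C y = Dom C m" "m \<cdot> x = m \<cdot> y"
  shows "x = y"
proof -
  have "x \<in> Hom C (Dom C x) (Dom C m)" "y \<in> Hom C (Dom C x) (Dom C m)" "Dom C x \<in> Obj C"
    using assms by simp_all
  then show ?thesis using assms(1,7) unfolding mono_arr_def by blast
qed

text \<open>A monomorphism reflects zero arrows, so \<open>e\<close> and \<open>m \<cdot> e\<close>
  annihilate the same arrows. This replaces an arbitrary arrow by the regular epimorphism of its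
  image factorisation without changing the kernel.\<close>

lemma kernel_Comp_mono:
  assumes "mono_arr C m" "Dom C m = Cod C e" "kernel C k (m \<cdot> e)" "e \<in> Arr C"
  shows "kernel C k e"
proof -
  have m: "m \<in> Arr C" using assms(1) unfolding mono_arr_def by auto
  note D = kernelD[OF assms(3)]
  show ?thesis
  proof (rule kernelI)
    show "zero_arr C (e \<cdot> k)"
      using _ _ _ _ mono_arr_cancel[OF assms(1)]
      by (rule zero_arr_reflect[of "e \<cdot> k" m]) (use D assms m in \<open>auto simp: assoc\<close>)
  next
    fix x assume x: "x \<in> Arr C" "Cod C x = Dom C e" "zero_arr C (e \<cdot> x)"
    have "zero_arr C ((m \<cdot> e) \<cdot> x)"
      using zero_arr_Comp_left[OF x(3), of m] x m assms by (simp add: assoc)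
    then show "\<exists>y. y \<in> Arr C \<and> Dom C y = Dom C x \<and> Cod C y = Dom C k \<and> k \<cdot> y = x"
      using kernel_lift[OF assms(3), of x] x m assms by auto
  qed (use D assms m kernel_cancel[OF assms(3)] in auto)
qed

text \<open>The new kernel is the arrow into the pullback induced by \<open>k\<close> and a zero
  arrow. It has the very domain of \<open>k\<close>, which gives stability of a class defined by its
  kernel objects.\<close>

lemma kernel_of_pullback:
  assumes P: "pullback C f g p q" and k: "kernel C k f"
  shows "\<exists>k'. kernel C k' q \<and> Dom C k' = Dom C k"
proof -
  note PD = pullbackD[OF P] and D = kernelD[OF k]
  obtain Z where Z: "zero_object C Z" using D(4) by (rule zero_arrE)
  obtain u where u: "u \<in> Arr C" "Dom C u = Dom C k" "Cod C u = Z" "zero_arr C u"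
    using zero_object_to[OF Z, of "Dom C k"] D by auto
  obtain v where v: "v \<in> Arr C" "Dom C v = Z" "Cod C v = Dom C g" "zero_arr C v"
    using zero_object_from[OF Z, of "Dom C g"] PD by auto
  have vu: "zero_arr C (v \<cdot> u)" using u v by (intro zero_arr_Comp_left) auto
  have "zero_arr C (g \<cdot> (v \<cdot> u))" using vu PD u v by (intro zero_arr_Comp_left) auto
  then have "f \<cdot> k = g \<cdot> (v \<cdot> u)"
    using D PD u v by (intro zero_arr_unique) auto
  then obtain k' where k': "k' \<in> Arr C" "Dom C k' = Dom C k" "Cod C k' = Dom C p"
      "p \<cdot> k' = k" "q \<cdot> k' = v \<cdot> u"
    using pullback_lift[OF P, of k "v \<cdot> u"] D u v by auto
  have "kernel C k' q"
  proof (rule kernelI)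
    fix x assume x: "x \<in> Arr C" "Cod C x = Dom C q" "zero_arr C (q \<cdot> x)"
    have "f \<cdot> (p \<cdot> x) = g \<cdot> (q \<cdot> x)" using x PD by (simp flip: assoc)
    then have "zero_arr C (f \<cdot> (p \<cdot> x))"
      using zero_arr_Comp_left[OF x(3), of g] x PD by simp
    then obtain y where y: "y \<in> Arr C" "Dom C y = Dom C x" "Cod C y = Dom C k" "k \<cdot> y = p \<cdot> x"
      using kernel_lift[OF k, of "p \<cdot> x"] x PD by auto
    have z: "zero_arr C (q \<cdot> (k' \<cdot> y))"
      using zero_arr_Comp_right[OF vu, of y] y k' u v PD by (simp flip: assoc)
    have "k' \<cdot> y = x"
    proof (rule pullback_unique[OF P])
      show "q \<cdot> (k' \<cdot> y) = q \<cdot> x"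
        using z x(3) by (rule zero_arr_unique) (use x y k' PD in auto)
    qed (use x y k' PD in \<open>simp_all flip: assoc\<close>)
    then show "\<exists>y. y \<in> Arr C \<and> Dom C y = Dom C x \<and> Cod C y = Dom C k' \<and> k' \<cdot> y = x"
      using y k' by auto
  next
    fix x y
    assume x: "x \<in> Arr C" "y \<in> Arr C" "Dom C x = Dom C y" "Cod C x = Dom C k'"
      "Cod C y = Dom C k'" "k' \<cdot> x = k' \<cdot> y"
    have "(p \<cdot> k') \<cdot> x = (p \<cdot> k') \<cdot> y"
      using x k'(1-3) PD by (simp add: assoc)
    then show "x = y" using kernel_cancel[OF k] x k' by simp
  qed (use k' PD vu in auto)
  then show ?thesis using k' by blast
qed

text \<open>A kernel is a pullback along \<open>0 \<rightarrow> B\<close>. The point is the other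
  leg: \<open>w\<close>, the arrow from \<open>K[f]\<close> to the zero object, is a pullback of
  \<open>f\<close> and inherits its stable properties.\<close>

lemma kernel_imp_pullback:
  assumes k: "kernel C k f" and Z: "zero_object C Z"
    and z: "z \<in> Arr C" "Dom C z = Z" "Cod C z = Cod C f"
    and w: "w \<in> Arr C" "Dom C w = Dom C k" "Cod C w = Z"
  shows "pullback C f z k w"
proof -
  note D = kernelD[OF k]
  have zw: "zero_arr C w" using zero_arr_to_zero_object Z w by blast
  have zz: "zero_arr C (z \<cdot> x)" if "x \<in> Arr C" "Cod C x = Z" for x
    using that z zero_arr_to_zero_object[OF Z, of x] by (intro zero_arr_Comp_left) auto
  show ?thesis
  proof (rule pullbackI)
    show "f \<cdot> k = z \<cdot> w" using D(4) zz by (rule zero_arr_unique) (use D z w in auto)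
  next
    fix x y assume x: "x \<in> Arr C" "y \<in> Arr C" "Dom C x = Dom C y" "Cod C x = Dom C f"
      "Cod C y = Dom C z" "f \<cdot> x = z \<cdot> y"
    have "zero_arr C (f \<cdot> x)" using x zz z by simp
    then obtain h where h: "h \<in> Arr C" "Dom C h = Dom C x" "Cod C h = Dom C k" "k \<cdot> h = x"
      using kernel_lift[OF k] x by metis
    moreover have "w \<cdot> h = y"
      by (rule zero_object_to_unique[OF Z]) (use w h x z in auto)
    ultimately show "\<exists>h. h \<in> Arr C \<and> Dom C h = Dom C x \<and> Cod C h = Dom C k \<and> k \<cdot> h = x \<and> w \<cdot> h = y"
      by blast
  qed (use D z w kernel_cancel[OF k] in auto)
qed

text \<open>The converse reading, by which finite completeness supplies kernels.\<close>

lemma pullback_imp_kernel: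
  assumes P: "pullback C f z k w" and Z: "zero_object C (Dom C z)"
  shows "kernel C k f"
proof -
  note D = pullbackD[OF P]
  have zz: "zero_arr C (z \<cdot> x)" if "x \<in> Arr C" "Cod C x = Dom C z" for x
    using that D zero_arr_to_zero_object[OF Z, of x] by (intro zero_arr_Comp_left) auto
  show ?thesis
  proof (rule kernelI)
    show "zero_arr C (f \<cdot> k)" using D zz by simp
  next
    fix x assume x: "x \<in> Arr C" "Cod C x = Dom C f" "zero_arr C (f \<cdot> x)"
    obtain y where y: "y \<in> Arr C" "Dom C y = Dom C x" "Cod C y = Dom C z"
      using zero_object_to[OF Z, of "Dom C x"] x by auto
    have "f \<cdot> x = z \<cdot> y" using x(3) zz by (rule zero_arr_unique) (use x y D in auto)
    then show "\<exists>y. y \<in> Arr C \<and> Dom C y = Dom C x \<and> Cod C y = Dom C k \<and> k \<cdot> y = x"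
      using pullback_lift[OF P, of x y] x y by metis
  next
    fix x y
    assume x: "x \<in> Arr C" "y \<in> Arr C" "Dom C x = Dom C y" "Cod C x = Dom C k"
      "Cod C y = Dom C k" "k \<cdot> x = k \<cdot> y"
    then show "x = y"
      using pullback_unique[OF P x(1-5)] zero_object_to_unique[OF Z, of "w \<cdot> x" "w \<cdot> y"] D by simp
  qed (use D in auto)
qed

text \<open>\<open>e'\<close> is the restriction of \<open>e\<close> to the kernels of
  \<open>m \<cdot> e\<close> and \<open>m\<close>. An arrow \<open>x\<close> for which
  \<open>e \<cdot> x\<close> factors through \<open>l\<close> is annihilated by
  \<open>m \<cdot> e\<close>, hence factors through \<open>k\<close>.\<close>

lemma pullback_of_kernels:
  assumes k: "kernel C k (m \<cdot> e)" and l: "kernel C l m"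
    and e: "e \<in> Arr C" "Dom C m = Cod C e"
  obtains e' where "pullback C e l k e'"
proof -
  note K = kernelD[OF k] and L = kernelD[OF l]
  have "zero_arr C (m \<cdot> (e \<cdot> k))" using K e L by (simp add: assoc)
  then obtain e' where e': "e' \<in> Arr C" "Dom C e' = Dom C k" "Cod C e' = Dom C l" "l \<cdot> e' = e \<cdot> k"
    using kernel_lift[OF l, of "e \<cdot> k"] K L e by auto
  have "pullback C e l k e'"
  proof (rule pullbackI)
    fix x y
    assume x: "x \<in> Arr C" "y \<in> Arr C" "Dom C x = Dom C y" "Cod C x = Dom C e"
      "Cod C y = Dom C l" "e \<cdot> x = l \<cdot> y"
    have "(m \<cdot> e) \<cdot> x = (m \<cdot> l) \<cdot> y" using x L e by (simp add: assoc)
    moreover have "zero_arr C ((m \<cdot> l) \<cdot> y)"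
      by (rule zero_arr_Comp_right) (use x L in auto)
    ultimately obtain h where h: "h \<in> Arr C" "Dom C h = Dom C x" "Cod C h = Dom C k" "k \<cdot> h = x"
      using kernel_lift[OF k, of x] x L e by auto
    have "l \<cdot> (e' \<cdot> h) = l \<cdot> y"
    proof -
      have "(l \<cdot> e') \<cdot> h = l \<cdot> (e' \<cdot> h)" "(e \<cdot> k) \<cdot> h = e \<cdot> (k \<cdot> h)"
        using h(1-3) e'(1-3) e K L by (simp_all add: assoc)
      then show ?thesis using x h e' by simp
    qed
    then have "e' \<cdot> h = y" using kernel_cancel[OF l] h e' x by simp
    with h show "\<exists>h. h \<in> Arr C \<and> Dom C h = Dom C x \<and> Cod C h = Dom C k \<and> k \<cdot> h = x \<and> e' \<cdot> h = y"
      by blast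
  qed (use K L e e' kernel_cancel[OF k] in auto)
  then show thesis by (rule that)
qed

text \<open>\<open>l\<close> reflects zero arrows, so \<open>e'\<close> annihilates \<open>x\<close>
  exactly when \<open>e\<close> annihilates \<open>k \<cdot> x\<close>. A kernel of \<open>e\<close>
  that factors through \<open>k\<close> thus restricts to a kernel of \<open>e'\<close>.\<close>

lemma kernel_through_pullback:
  assumes P: "pullback C e l k e'" and l: "kernel C l m" and n: "kernel C (k \<cdot> n) e"
    and nA: "n \<in> Arr C" "Cod C n = Dom C k" and k: "kernel C k f"
  shows "kernel C n e'"
proof -
  note D = pullbackD[OF P] and N = kernelD[OF n] and K = kernelD[OF k]
  have sw: "l \<cdot> (e' \<cdot> x) = e \<cdot> (k \<cdot> x)" if "x \<in> Arr C" "Cod C x = Dom C k" for x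
    using that D by (simp flip: assoc)
  have lz: "zero_arr C (e' \<cdot> x)" if "zero_arr C (e \<cdot> (k \<cdot> x))" "x \<in> Arr C" "Cod C x = Dom C k" for x
    by (rule zero_arr_reflect[of _ l])
      (use that D sw kernel_cancel[OF l] in auto)
  show ?thesis
  proof (rule kernelI)
    show "zero_arr C (e' \<cdot> n)" using lz N nA by simp
  next
    fix x assume x: "x \<in> Arr C" "Cod C x = Dom C e'" "zero_arr C (e' \<cdot> x)"
    have "zero_arr C (e \<cdot> (k \<cdot> x))"
      using zero_arr_Comp_left[OF x(3), of l] sw[of x] x D by simp
    then obtain y where y: "y \<in> Arr C" "Dom C y = Dom C x" "Cod C y = Dom C n" "(k \<cdot> n) \<cdot> y = k \<cdot> x"
      using kernel_lift[OF n, of "k \<cdot> x"] x D nA by auto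
    have "n \<cdot> y = x"
      by (rule kernel_cancel[OF k]) (use y x nA D in \<open>simp_all add: assoc\<close>)
    with y show "\<exists>y. y \<in> Arr C \<and> Dom C y = Dom C x \<and> Cod C y = Dom C n \<and> n \<cdot> y = x"
      by blast
  next
    fix x y
    assume x: "x \<in> Arr C" "y \<in> Arr C" "Dom C x = Dom C y" "Cod C x = Dom C n"
      "Cod C y = Dom C n" "n \<cdot> x = n \<cdot> y"
    show "x = y"
      by (rule kernel_cancel[OF n]) (use x nA D in \<open>simp_all add: assoc\<close>)
  qed (use D nA in auto)
qed

section \<open>Orthogonality\<close>

lemma orthogonalD:
  assumes "orthogonal C e m" "a \<in> Arr C" "b \<in> Arr C" "Dom C a = Dom C e" "Cod C a = Dom C m"
    "Dom C b = Cod C e" "Cod C b = Cod C m" "b \<cdot> e = m \<cdot> a"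
  shows "\<exists>!d. d \<in> Hom C (Cod C e) (Dom C m) \<and> d \<cdot> e = a \<and> m \<cdot> d = b"
proof -
  have "a \<in> Hom C (Dom C e) (Dom C m)" "b \<in> Hom C (Cod C e) (Cod C m)"
    using assms by simp_all
  then show ?thesis using assms(1,8) unfolding orthogonal_def by blast
qed

lemma orthogonal_lift:
  assumes "orthogonal C e m" "a \<in> Arr C" "b \<in> Arr C" "Dom C a = Dom C e" "Cod C a = Dom C m"
    "Dom C b = Cod C e" "Cod C b = Cod C m" "b \<cdot> e = m \<cdot> a"
  shows "\<exists>d. d \<in> Arr C \<and> Dom C d = Cod C e \<and> Cod C d = Dom C m
    \<and> d \<cdot> e = a \<and> m \<cdot> d = b"
  using orthogonalD[OF assms] by auto

text \<open>The diagonal against \<open>m\<close> and the arrow \<open>b\<close> together induce the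
  diagonal against \<open>q\<close>; all equations are then checked on the two projections.\<close>

lemma orthogonal_pullback:
  assumes o: "orthogonal C e m" and P: "pullback C m g p q" and e: "e \<in> Arr C"
  shows "orthogonal C e q"
  unfolding orthogonal_def
proof (intro ballI impI)
  note D = pullbackD[OF P]
  fix a b assume a: "a \<in> Hom C (Dom C e) (Dom C q)" and b: "b \<in> Hom C (Cod C e) (Cod C q)"
    and eq: "b \<cdot> e = q \<cdot> a"
  have "(g \<cdot> b) \<cdot> e = g \<cdot> (q \<cdot> a)" using a b e D eq by (simp add: assoc)
  also have "\<dots> = (m \<cdot> p) \<cdot> a" using a D by (simp add: assoc)
  also have "\<dots> = m \<cdot> (p \<cdot> a)" using a D by (intro assoc) auto
  finally have "\<exists>!d. d \<in> Hom C (Cod C e) (Dom C m) \<and> d \<cdot> e = p \<cdot> a \<and> m \<cdot> d = g \<cdot> b"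
    using a b D e by (intro orthogonalD[OF o]) auto
  \<comment> \<open>The uniqueness half is kept as \<open>du\<close>: it determines
    \<open>p \<cdot> h'\<close> for a competing diagonal \<open>h'\<close>.\<close>
  then obtain d where dH: "d \<in> Hom C (Cod C e) (Dom C m)" "d \<cdot> e = p \<cdot> a" "m \<cdot> d = g \<cdot> b"
    and du: "\<And>d'. d' \<in> Hom C (Cod C e) (Dom C m) \<Longrightarrow> d' \<cdot> e = p \<cdot> a \<Longrightarrow> m \<cdot> d' = g \<cdot> b \<Longrightarrow> d' = d"
    unfolding Ex1_def by blast
  have d: "d \<in> Arr C" "Dom C d = Cod C e" "Cod C d = Dom C m" using dH by simp_all
  obtain h where h: "h \<in> Arr C" "Dom C h = Dom C d" "Cod C h = Dom C p" "p \<cdot> h = d" "q \<cdot> h = b"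
    using pullback_lift[OF P d(1), of b] d dH(3) b D by auto
  show "\<exists>!d. d \<in> Hom C (Cod C e) (Dom C q) \<and> d \<cdot> e = a \<and> q \<cdot> d = b"
  proof (rule ex1I)
    have "h \<cdot> e = a"
    proof (rule pullback_unique[OF P])
      show "p \<cdot> (h \<cdot> e) = p \<cdot> a" "q \<cdot> (h \<cdot> e) = q \<cdot> a"
        using h d dH(2) e eq D(4-8) by (simp_all flip: assoc)
    qed (use h d e a D in auto)
    then show "h \<in> Hom C (Cod C e) (Dom C q) \<and> h \<cdot> e = a \<and> q \<cdot> h = b"
      using h d D by simp
  next
    fix h' assume "h' \<in> Hom C (Cod C e) (Dom C q) \<and> h' \<cdot> e = a \<and> q \<cdot> h' = b"
    then have h': "h' \<in> Arr C" "Dom C h' = Cod C e" "Cod C h' = Dom C q" "h' \<cdot> e = a" "q \<cdot> h' = b"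
      by simp_all
    have ph': "p \<cdot> h' = d"
    proof (rule du)
      show "(p \<cdot> h') \<cdot> e = p \<cdot> a" using h' D e by (simp add: assoc)
      have "(m \<cdot> p) \<cdot> h' = m \<cdot> (p \<cdot> h')" "(g \<cdot> q) \<cdot> h' = g \<cdot> (q \<cdot> h')"
        using h'(1-3) D(1-8) by (simp_all add: assoc)
      then show "m \<cdot> (p \<cdot> h') = g \<cdot> b" using h'(5) D(9) by simp
    qed (use h'(1-3) D(1-8) in simp)
    show "h' = h" by (rule pullback_unique[OF P]) (use ph' h h' d D(4-8) in simp_all)
  qed
qed

end

section \<open>Finite limits\<close>

text \<open>
  The category generated by the graph with vertices \<open>0, \<dots>, n - 1\<close> and edges \<open>n, \<dots>, n + k - 1\<close>,
  provided that no two edges are composable; vertices double as identities.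
\<close>

definition graph_cat :: "nat \<Rightarrow> nat \<Rightarrow> (nat \<Rightarrow> nat) \<Rightarrow> (nat \<Rightarrow> nat) \<Rightarrow> (nat, nat) cat" where
  "graph_cat n k s d = \<lparr>Obj = {..<n}, Arr = {..<n + k},
     Dom = (\<lambda>a. if a < n then a else s a), Cod = (\<lambda>a. if a < n then a else d a),
     Ident = (\<lambda>i. i), Comp = (\<lambda>v u. if u < n then v else u)\<rparr>"

lemma graph_cat_category:
  assumes "\<And>a. n \<le> a \<Longrightarrow> a < n + k \<Longrightarrow> s a < n \<and> d a < n"
    and "\<And>a b. n \<le> a \<Longrightarrow> a < n + k \<Longrightarrow> n \<le> b \<Longrightarrow> b < n + k \<Longrightarrow> d a \<noteq> s b"
  shows "category (graph_cat n k s d)"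
proof -
  let ?J = "graph_cat n k s d"
  have Hom: "u \<in> Hom ?J i j \<longleftrightarrow> u < n \<and> i = u \<and> j = u \<or> n \<le> u \<and> u < n + k \<and> i = s u \<and> j = d u"
    for u i j
    by (auto simp: graph_cat_def Hom_def)
  have Comp: "Comp ?J v u = (if u < n then v else u)" for u v
    by (simp add: graph_cat_def)
  \<comment> \<open>Of two composable arrows at least one is an identity, so \<open>Comp\<close>,
    which returns one of its arguments, always returns the right one.\<close>
  have composable: "u < n \<or> v < n" if "u \<in> Hom ?J i j" "v \<in> Hom ?J j l" for u v i j l
    using that assms(2)[of u v] unfolding Hom by auto
  show ?thesis
  proof unfold_locales
    fix f X Y g Z assume "f \<in> Hom ?J X Y" "g \<in> Hom ?J Y Z"
    then show "Comp ?J g f \<in> Hom ?J X Z"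
      using composable[of f X Y g Z] assms(1)[of f] unfolding Hom Comp by auto
  next
    fix f W X g Y h Z assume "f \<in> Hom ?J W X" "g \<in> Hom ?J X Y" "h \<in> Hom ?J Y Z"
    then show "Comp ?J (Comp ?J h g) f = Comp ?J h (Comp ?J g f)"
      unfolding Comp by simp
  next
    fix f assume "f \<in> Arr ?J"
    then show "Dom ?J f \<in> Obj ?J" "Cod ?J f \<in> Obj ?J"
      using assms(1)[of f] by (auto simp: graph_cat_def)
  next
    fix f X Y assume "f \<in> Hom ?J X Y"
    then show "Comp ?J (Ident ?J Y) f = f" "Comp ?J f (Ident ?J X) = f"
      using assms(1)[of f] by (auto simp: Hom Comp) (auto simp: graph_cat_def)
  next
    fix X assume "X \<in> Obj ?J"
    then show "Ident ?J X \<in> Hom ?J X X" by (simp add: graph_cat_def Hom_def)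
  qed
qed

context category
begin

text \<open>Cone conditions at identities hold automatically, so limits over the generated category
  can be stated with vertices and edges alone. The functor \<open>G\<close> extends the edge data by
  identities on the arrows below \<open>n\<close>.\<close>

lemma graph_limit:
  fixes n k :: nat
  assumes complete: "finitely_complete C"
    and graph: "\<And>a. n \<le> a \<Longrightarrow> a < n + k \<Longrightarrow> s a < n \<and> d a < n"
      "\<And>a b. n \<le> a \<Longrightarrow> a < n + k \<Longrightarrow> n \<le> b \<Longrightarrow> b < n + k \<Longrightarrow> d a \<noteq> s b"
    and Fo: "\<And>i. i < n \<Longrightarrow> Fo i \<in> Obj C"
    and Fa: "\<And>a. n \<le> a \<Longrightarrow> a < n + k \<Longrightarrow> Fa a \<in> Hom C (Fo (s a)) (Fo (d a))"
  obtains L \<pi> where "\<forall>i<n. \<pi> i \<in> Hom C L (Fo i)"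
    "\<forall>a. n \<le> a \<and> a < n + k \<longrightarrow> Fa a \<cdot> \<pi> (s a) = \<pi> (d a)"
    "\<forall>X \<xi>. X \<in> Obj C \<and> (\<forall>i<n. \<xi> i \<in> Hom C X (Fo i)) \<and>
       (\<forall>a. n \<le> a \<and> a < n + k \<longrightarrow> Fa a \<cdot> \<xi> (s a) = \<xi> (d a)) \<longrightarrow>
       (\<exists>!h. h \<in> Hom C X L \<and> (\<forall>i<n. \<pi> i \<cdot> h = \<xi> i))"
proof -
  let ?J = "graph_cat n k s d"
  define G where "G a = (if a < n then Ident C (Fo a) else Fa a)" for a
  interpret J: category ?J using graph by (rule graph_cat_category)
  have "functor_between ?J C Fo G"
  proof unfold_locales
    fix u i j assume "u \<in> Hom ?J i j"
    then show "G u \<in> Hom C (Fo i) (Fo j)"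
      using Fo Fa[of u] by (auto simp: G_def graph_cat_def Hom_def split: if_splits)
  next
    fix u v i j l assume u: "u \<in> Hom ?J i j" and v: "v \<in> Hom ?J j l"
    show "G (Comp ?J v u) = G v \<cdot> G u"
    proof (cases "u < n")
      case True
      then show ?thesis
        using u v Fo Fa[of v] by (auto simp: G_def graph_cat_def Hom_def split: if_splits)
    next
      case False
      then have "v < n" using u v graph(2)[of u v]
        by (auto simp: graph_cat_def Hom_def split: if_splits)
      then show ?thesis
        using False u v Fo Fa[of u] by (auto simp: G_def graph_cat_def Hom_def split: if_splits)
    qed
  qed (auto simp: Fo G_def graph_cat_def)
  moreover have "finite (Obj ?J)" "finite (Arr ?J)" by (simp_all add: graph_cat_def)
  ultimately obtain L \<pi> where L: "limit_cone ?J C Fo G L \<pi>"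
    using complete unfolding finitely_complete_def by blast
  have cone: "cone ?J C Fo G X \<xi> \<longleftrightarrow> X \<in> Obj C \<and> (\<forall>i<n. \<xi> i \<in> Hom C X (Fo i)) \<and>
       (\<forall>a. n \<le> a \<and> a < n + k \<longrightarrow> Fa a \<cdot> \<xi> (s a) = \<xi> (d a))" for X \<xi>
    unfolding cone_def
    by (auto simp: graph_cat_def G_def Fo not_less)
  have Obj: "Obj ?J = {..<n}" by (simp add: graph_cat_def)
  show thesis
  proof (rule that)
    show "\<forall>X \<xi>. X \<in> Obj C \<and> (\<forall>i<n. \<xi> i \<in> Hom C X (Fo i)) \<and>
       (\<forall>a. n \<le> a \<and> a < n + k \<longrightarrow> Fa a \<cdot> \<xi> (s a) = \<xi> (d a)) \<longrightarrow>
       (\<exists>!h. h \<in> Hom C X L \<and> (\<forall>i<n. \<pi> i \<cdot> h = \<xi> i))"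
      unfolding cone[symmetric]
    proof (intro allI impI)
      fix X \<xi> assume "cone ?J C Fo G X \<xi>"
      then have "\<exists>!h. h \<in> Hom C X L \<and> (\<forall>i \<in> Obj ?J. \<pi> i \<cdot> h = \<xi> i)"
        using L unfolding limit_cone_def by blast
      then show "\<exists>!h. h \<in> Hom C X L \<and> (\<forall>i<n. \<pi> i \<cdot> h = \<xi> i)"
        unfolding Obj Ball_def lessThan_iff .
    qed
  qed (use L in \<open>simp_all add: limit_cone_def cone del: mem_Hom\<close>)
qed

section \<open>Pullbacks and equalisers as finite limits\<close>

lemma pullback_exists:
  assumes complete: "finitely_complete C"
    and f: "f \<in> Arr C" and g: "g \<in> Arr C" and fg: "Cod C f = Cod C g"
  obtains p q where "pullback C f g p q"
proof -
  \<comment> \<open>Vertices 0, 1, 2 carry \<open>Dom C f\<close>, \<open>Dom C g\<close> and the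
    common codomain. The edges are then numbered 3 and 4 and carry \<open>f\<close> and
    \<open>g\<close>; source \<open>a - 3\<close> and target 2 make them run from 0 and 1 to
    2.\<close>
  define Fo where "Fo i = (if i = 0 then Dom C f else if i = 1 then Dom C g else Cod C f)" for i :: nat
  define Fa where "Fa a = (if a = 3 then f else g)" for a :: nat
  obtain L \<pi> where L: "\<forall>i<3. \<pi> i \<in> Hom C L (Fo i)"
    "\<forall>a. 3 \<le> a \<and> a < 3 + 2 \<longrightarrow> Fa a \<cdot> \<pi> (a - 3) = \<pi> 2"
    "\<forall>X \<xi>. X \<in> Obj C \<and> (\<forall>i<3. \<xi> i \<in> Hom C X (Fo i)) \<and>
       (\<forall>a. 3 \<le> a \<and> a < 3 + 2 \<longrightarrow> Fa a \<cdot> \<xi> (a - 3) = \<xi> 2) \<longrightarrow>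
       (\<exists>!h. h \<in> Hom C X L \<and> (\<forall>i<3. \<pi> i \<cdot> h = \<xi> i))"
    by (rule graph_limit[where n = 3 and k = 2 and s = "\<lambda>a. a - 3" and d = "\<lambda>_. 2" and Fo = Fo
          and Fa = Fa, OF complete _ _ _ _ that])
      (use f g fg in \<open>auto simp: Fo_def Fa_def\<close>)
  have three: "(\<forall>i<3. P i) \<longleftrightarrow> P 0 \<and> P 1 \<and> P 2" for P :: "nat \<Rightarrow> bool"
    by (auto simp: less_Suc_eq numeral_3_eq_3 numeral_2_eq_2)
  have two: "(\<forall>a. 3 \<le> a \<and> a < 3 + 2 \<longrightarrow> P a) \<longleftrightarrow> P 3 \<and> P 4" for P :: "nat \<Rightarrow> bool"
    by (auto simp: le_less_Suc_eq numeral_eq_Suc le_Suc_eq less_Suc_eq)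
  have \<pi>: "\<pi> 0 \<in> Arr C" "Dom C (\<pi> 0) = L" "Cod C (\<pi> 0) = Dom C f"
      "\<pi> 1 \<in> Arr C" "Dom C (\<pi> 1) = L" "Cod C (\<pi> 1) = Dom C g"
      "f \<cdot> \<pi> 0 = \<pi> 2" "g \<cdot> \<pi> 1 = \<pi> 2"
    using L(1,2) unfolding three two by (simp_all add: Fo_def Fa_def)
  have lim: "\<exists>!h. h \<in> Hom C (Dom C x) L \<and> \<pi> 0 \<cdot> h = x \<and> \<pi> 1 \<cdot> h = y"
    if "x \<in> Arr C" "y \<in> Arr C" "Dom C x = Dom C y" "Cod C x = Dom C f" "Cod C y = Dom C g"
      "f \<cdot> x = g \<cdot> y" for x y
  proof -
    let ?\<xi> = "\<lambda>i :: nat. if i = 0 then x else if i = 1 then y else f \<cdot> x"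
    have "\<exists>!h. h \<in> Hom C (Dom C x) L \<and> (\<forall>i<3. \<pi> i \<cdot> h = ?\<xi> i)"
      by (rule L(3)[rule_format]) (use that f g fg in \<open>unfold three two, simp add: Fo_def Fa_def\<close>)
    moreover have "(\<forall>i<3. \<pi> i \<cdot> h = ?\<xi> i) \<longleftrightarrow> \<pi> 0 \<cdot> h = x \<and> \<pi> 1 \<cdot> h = y"
      if "h \<in> Hom C (Dom C x) L" for h
    proof -
      have "\<pi> 2 \<cdot> h = f \<cdot> (\<pi> 0 \<cdot> h)"
        unfolding \<pi>(7)[symmetric] by (rule assoc) (use that \<pi> f in auto)
      then show ?thesis unfolding three by auto
    qed
    ultimately show ?thesis by (simp cong: conj_cong del: mem_Hom)
  qed
  have "pullback C f g (\<pi> 0) (\<pi> 1)"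
  proof (rule pullbackI)
    fix x y
    assume x: "x \<in> Arr C" "y \<in> Arr C" "Dom C x = Dom C y" "Cod C x = Dom C f" "Cod C y = Dom C g"
      "f \<cdot> x = g \<cdot> y"
    then show "\<exists>h. h \<in> Arr C \<and> Dom C h = Dom C x \<and> Cod C h = Dom C (\<pi> 0) \<and> \<pi> 0 \<cdot> h = x
        \<and> \<pi> 1 \<cdot> h = y"
      using lim[OF x] \<pi> by auto
  next
    fix x y
    assume x: "x \<in> Arr C" "y \<in> Arr C" "Dom C x = Dom C y" "Cod C x = Dom C (\<pi> 0)"
      "Cod C y = Dom C (\<pi> 0)" "\<pi> 0 \<cdot> x = \<pi> 0 \<cdot> y" "\<pi> 1 \<cdot> x = \<pi> 1 \<cdot> y"
    have "f \<cdot> (\<pi> 0 \<cdot> x) = g \<cdot> (\<pi> 1 \<cdot> x)"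
      using x(1,4) \<pi> f g by (simp flip: assoc)
    then have "\<exists>!h. h \<in> Hom C (Dom C (\<pi> 0 \<cdot> x)) L \<and> \<pi> 0 \<cdot> h = \<pi> 0 \<cdot> x \<and> \<pi> 1 \<cdot> h = \<pi> 1 \<cdot> x"
      using x \<pi> by (intro lim) auto
    moreover have "x \<in> Hom C (Dom C (\<pi> 0 \<cdot> x)) L" "y \<in> Hom C (Dom C (\<pi> 0 \<cdot> x)) L"
      using x(1-5) \<pi> by simp_all
    ultimately show "x = y" using x(6,7) by metis
  qed (use \<pi> f g fg in auto)
  then show thesis by (rule that)
qed

lemma equaliser_exists:
  assumes complete: "finitely_complete C"
    and u: "u \<in> Arr C" and v: "v \<in> Arr C" and uv: "Dom C u = Dom C v" "Cod C u = Cod C v"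
  obtains e where "e \<in> Arr C" "Cod C e = Dom C u" "u \<cdot> e = v \<cdot> e"
    "\<And>x. x \<in> Arr C \<Longrightarrow> Cod C x = Dom C u \<Longrightarrow> u \<cdot> x = v \<cdot> x \<Longrightarrow>
      \<exists>h. h \<in> Arr C \<and> Dom C h = Dom C x \<and> Cod C h = Dom C e \<and> e \<cdot> h = x"
    "\<And>x y. x \<in> Arr C \<Longrightarrow> y \<in> Arr C \<Longrightarrow> Dom C x = Dom C y \<Longrightarrow> Cod C x = Dom C e \<Longrightarrow>
      Cod C y = Dom C e \<Longrightarrow> e \<cdot> x = e \<cdot> y \<Longrightarrow> x = y"
proof -
  \<comment> \<open>With two vertices the edges are numbered 2 and 3; both run from 0 to 1 and carry
    \<open>u\<close> and \<open>v\<close>.\<close>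
  define Fo where "Fo i = (if i = 0 then Dom C u else Cod C u)" for i :: nat
  define Fa where "Fa a = (if a = 2 then u else v)" for a :: nat
  obtain L \<pi> where L: "\<forall>i<2. \<pi> i \<in> Hom C L (Fo i)"
    "\<forall>a. 2 \<le> a \<and> a < 2 + 2 \<longrightarrow> Fa a \<cdot> \<pi> 0 = \<pi> 1"
    "\<forall>X \<xi>. X \<in> Obj C \<and> (\<forall>i<2. \<xi> i \<in> Hom C X (Fo i)) \<and>
       (\<forall>a. 2 \<le> a \<and> a < 2 + 2 \<longrightarrow> Fa a \<cdot> \<xi> 0 = \<xi> 1) \<longrightarrow>
       (\<exists>!h. h \<in> Hom C X L \<and> (\<forall>i<2. \<pi> i \<cdot> h = \<xi> i))"
    by (rule graph_limit[where n = 2 and k = 2 and s = "\<lambda>_. 0" and d = "\<lambda>_. 1" and Fo = Fo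
          and Fa = Fa, OF complete _ _ _ _ that])
      (use u v uv in \<open>auto simp: Fo_def Fa_def\<close>)
  have vertices: "(\<forall>i<2. P i) \<longleftrightarrow> P 0 \<and> P 1" for P :: "nat \<Rightarrow> bool"
    by (auto simp: less_Suc_eq numeral_2_eq_2)
  have edges: "(\<forall>a. 2 \<le> a \<and> a < 2 + 2 \<longrightarrow> P a) \<longleftrightarrow> P 2 \<and> P 3" for P :: "nat \<Rightarrow> bool"
    by (auto simp: le_less_Suc_eq numeral_eq_Suc le_Suc_eq less_Suc_eq)
  have \<pi>: "\<pi> 0 \<in> Arr C" "Dom C (\<pi> 0) = L" "Cod C (\<pi> 0) = Dom C u"
      "u \<cdot> \<pi> 0 = \<pi> 1" "v \<cdot> \<pi> 0 = \<pi> 1"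
    using L(1,2) unfolding vertices edges by (simp_all add: Fo_def Fa_def)
  have lim: "\<exists>!h. h \<in> Hom C (Dom C x) L \<and> \<pi> 0 \<cdot> h = x"
    if x: "x \<in> Arr C" "Cod C x = Dom C u" "u \<cdot> x = v \<cdot> x" for x
  proof -
    let ?\<xi> = "\<lambda>i :: nat. if i = 0 then x else u \<cdot> x"
    have "\<exists>!h. h \<in> Hom C (Dom C x) L \<and> (\<forall>i<2. \<pi> i \<cdot> h = ?\<xi> i)"
      by (rule L(3)[rule_format])
        (use x u v uv in \<open>unfold vertices edges, simp add: Fo_def Fa_def\<close>)
    moreover have "(\<forall>i<2. \<pi> i \<cdot> h = ?\<xi> i) \<longleftrightarrow> \<pi> 0 \<cdot> h = x" if "h \<in> Hom C (Dom C x) L" for h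
    proof -
      have "\<pi> 1 \<cdot> h = u \<cdot> (\<pi> 0 \<cdot> h)"
        unfolding \<pi>(4)[symmetric] by (rule assoc) (use that \<pi> u in auto)
      then show ?thesis unfolding vertices by auto
    qed
    ultimately show ?thesis by (simp cong: conj_cong del: mem_Hom)
  qed
  show thesis
  proof (rule that)
    fix x assume x: "x \<in> Arr C" "Cod C x = Dom C u" "u \<cdot> x = v \<cdot> x"
    show "\<exists>h. h \<in> Arr C \<and> Dom C h = Dom C x \<and> Cod C h = Dom C (\<pi> 0) \<and> \<pi> 0 \<cdot> h = x"
      using lim[OF x] \<pi>(2) by auto
  next
    fix x y
    assume x: "x \<in> Arr C" "y \<in> Arr C" "Dom C x = Dom C y" "Cod C x = Dom C (\<pi> 0)"
      "Cod C y = Dom C (\<pi> 0)" "\<pi> 0 \<cdot> x = \<pi> 0 \<cdot> y"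
    have "u \<cdot> (\<pi> 0 \<cdot> x) = v \<cdot> (\<pi> 0 \<cdot> x)"
      using x(1,4) \<pi> u v uv by (simp flip: assoc)
    then have "\<exists>!h. h \<in> Hom C (Dom C (\<pi> 0 \<cdot> x)) L \<and> \<pi> 0 \<cdot> h = \<pi> 0 \<cdot> x"
      using x \<pi> by (intro lim) auto
    moreover have "x \<in> Hom C (Dom C (\<pi> 0 \<cdot> x)) L" "y \<in> Hom C (Dom C (\<pi> 0 \<cdot> x)) L"
      using x(1-5) \<pi> by simp_all
    ultimately show "x = y" using x(6) by metis
  qed (use \<pi> in auto)
qed

end

section \<open>Regular and normal epimorphisms\<close>

context category
begin

lemma coequaliserD:
  assumes "coequaliser C q f g"
  shows "f \<in> Arr C" "g \<in> Arr C" "Dom C g = Dom C f" "Cod C g = Cod C f" "q \<in> Arr C"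
    "Dom C q = Cod C f" "q \<cdot> f = q \<cdot> g"
  using assms unfolding coequaliser_def by simp_all

lemma coequaliser_lift:
  assumes "coequaliser C q f g" "x \<in> Arr C" "Dom C x = Cod C f" "x \<cdot> f = x \<cdot> g"
  shows "\<exists>y. y \<in> Arr C \<and> Dom C y = Cod C q \<and> Cod C y = Cod C x \<and> y \<cdot> q = x"
proof -
  have "\<exists>!y. y \<in> Hom C (Cod C q) (Cod C x) \<and> y \<cdot> q = x"
    using assms unfolding coequaliser_def by blast
  then show ?thesis by auto
qed

lemma coequaliser_cancel:
  assumes q: "coequaliser C q f g" and x: "x \<in> Arr C" "y \<in> Arr C" "Cod C x = Cod C y"
    "Dom C x = Cod C q" "Dom C y = Cod C q" "x \<cdot> q = y \<cdot> q"
  shows "x = y"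
proof -
  note D = coequaliserD[OF q]
  have "(y \<cdot> q) \<cdot> f = (y \<cdot> q) \<cdot> g" "y \<cdot> q \<in> Arr C" "Dom C (y \<cdot> q) = Cod C f"
      "Cod C (y \<cdot> q) = Cod C x"
    using D x by (simp_all add: assoc)
  then have "\<exists>!z. z \<in> Hom C (Cod C q) (Cod C x) \<and> z \<cdot> q = y \<cdot> q"
    using q unfolding coequaliser_def by metis
  moreover have "x \<in> Hom C (Cod C q) (Cod C x)" "y \<in> Hom C (Cod C q) (Cod C x)"
    using x by simp_all
  ultimately show ?thesis using x(6) by blast
qed

lemma regular_epi_Arr: "regular_epi C q \<Longrightarrow> q \<in> Arr C"
  unfolding regular_epi_def using coequaliserD(5) by blast

lemma normal_epi_Arr: "normal_epi C q \<Longrightarrow> q \<in> Arr C"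
  unfolding normal_epi_def using cokernelD(2) by blast

lemma zero_arr_exists:
  assumes "zero_object C Z" "X \<in> Obj C" "Y \<in> Obj C"
  shows "\<exists>f. f \<in> Arr C \<and> Dom C f = X \<and> Cod C f = Y \<and> zero_arr C f"
proof -
  obtain u where u: "u \<in> Arr C" "Dom C u = X" "Cod C u = Z"
    using zero_object_to[OF assms(1,2)] by blast
  obtain v where v: "v \<in> Arr C" "Dom C v = Z" "Cod C v = Y"
    using zero_object_from[OF assms(1,3)] by blast
  have "zero_arr C (v \<cdot> u)" by (rule zero_arrI[OF assms(1)]) (use u v in auto)
  then show ?thesis using u v by (intro exI[of _ "v \<cdot> u"]) simp
qed

text \<open>If \<open>q\<close> is the cokernel of \<open>g\<close>, then \<open>g\<close> factors
  through \<open>k\<close>, so whatever annihilates \<open>k\<close> annihilates \<open>g\<close>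
  and descends along \<open>q\<close>. This trades the unknown \<open>g\<close> hidden in
  \<open>normal_epi\<close> for the kernel at hand.\<close>

lemma normal_epi_cokernel:
  assumes q: "normal_epi C q" and k: "kernel C k q"
  shows "cokernel C q k"
proof -
  obtain g where g: "cokernel C q g" using q unfolding normal_epi_def by blast
  note G = cokernelD[OF g] and K = kernelD[OF k]
  obtain g' where g': "g' \<in> Arr C" "Dom C g' = Dom C g" "Cod C g' = Dom C k" "k \<cdot> g' = g"
    using kernel_lift[OF k, of g] G by auto
  show ?thesis
  proof (rule cokernelI)
    fix x assume x: "x \<in> Arr C" "Dom C x = Cod C k" "zero_arr C (x \<cdot> k)"
    have "(x \<cdot> k) \<cdot> g' = x \<cdot> g" using x(1,2) g' K by (simp add: assoc)
    then have "zero_arr C (x \<cdot> g)"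
      using zero_arr_Comp_right[OF x(3), of g'] x(1,2) g' K by simp
    then show "\<exists>y. y \<in> Arr C \<and> Dom C y = Cod C q \<and> Cod C y = Cod C x \<and> y \<cdot> q = x"
      using cokernel_lift[OF g, of x] x(1,2) G K by simp
  qed (use G K cokernel_cancel[OF g] in auto)
qed

text \<open>A cokernel of \<open>f\<close> is a coequaliser of \<open>f\<close> and the parallel
  zero arrow.\<close>

lemma normal_epi_imp_regular_epi:
  assumes "normal_epi C q"
  shows "regular_epi C q"
proof -
  obtain f where f: "cokernel C q f" using assms unfolding normal_epi_def by blast
  note D = cokernelD[OF f]
  obtain Z where Z: "zero_object C Z" using D(4) by (rule zero_arrE)
  obtain z where z: "z \<in> Arr C" "Dom C z = Dom C f" "Cod C z = Cod C f" "zero_arr C z"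
    using zero_arr_exists[OF Z Obj_Dom[OF D(1)] Obj_Cod[OF D(1)]] by blast
  have iff: "x \<cdot> f = x \<cdot> z \<longleftrightarrow> zero_arr C (x \<cdot> f)" if "x \<in> Arr C" "Dom C x = Cod C f" for x
  proof -
    have xz: "zero_arr C (x \<cdot> z)" by (rule zero_arr_Comp_left) (use that z in auto)
    show ?thesis
    proof
      assume "zero_arr C (x \<cdot> f)"
      then show "x \<cdot> f = x \<cdot> z" using xz by (rule zero_arr_unique) (use that z D in auto)
    qed (use xz in simp)
  qed
  have "coequaliser C q f z"
    unfolding coequaliser_def
  proof (intro conjI ballI impI)
    fix x assume "x \<in> Arr C" "Dom C x = Cod C f \<and> x \<cdot> f = x \<cdot> z"
    then show "\<exists>!y. y \<in> Hom C (Cod C q) (Cod C x) \<and> y \<cdot> q = x"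
      using f iff[of x] unfolding cokernel_def by blast
  qed (use D z iff in simp_all)
  then show ?thesis unfolding regular_epi_def by blast
qed

text \<open>Each kernel factors through the other as soon as each arrow annihilates the other's
  kernel; \<open>f\<close> and \<open>f'\<close> may have different codomains.\<close>

lemma kernels_iso:
  assumes k: "kernel C k f" and k': "kernel C k' f'" and d: "Dom C f = Dom C f'"
    and z: "zero_arr C (f' \<cdot> k)" "zero_arr C (f \<cdot> k')"
  obtains i where "iso C i" "Dom C i = Dom C k" "Cod C i = Dom C k'" "k' \<cdot> i = k"
proof -
  note D = kernelD[OF k] and D' = kernelD[OF k']
  obtain i where i: "i \<in> Arr C" "Dom C i = Dom C k" "Cod C i = Dom C k'" "k' \<cdot> i = k"
    using kernel_lift[OF k', of k] z D D' d by auto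
  obtain j where j: "j \<in> Arr C" "Dom C j = Dom C k'" "Cod C j = Dom C k" "k \<cdot> j = k'"
    using kernel_lift[OF k, of k'] z D D' d by auto
  have "j \<cdot> i = Ident C (Dom C i)"
    by (rule kernel_cancel[OF k]) (use i j D in \<open>simp_all flip: assoc\<close>)
  moreover have "i \<cdot> j = Ident C (Cod C i)"
    by (rule kernel_cancel[OF k']) (use i j D' in \<open>simp_all flip: assoc\<close>)
  ultimately have "iso C i" using i j by (intro isoI[of i j]) simp_all
  then show thesis using i that by blast
qed

end

context homological_category
begin

section \<open>Consequences of regularity and protomodularity\<close>

lemma kernel_exists:
  assumes "f \<in> Arr C"
  shows "\<exists>k. kernel C k f"
proof -
  obtain Z where Z: "zero_object C Z" using has_zero_object by blast
  obtain z where z: "z \<in> Arr C" "Dom C z = Z" "Cod C z = Cod C f"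
    using zero_object_from[OF Z Obj_Cod[OF assms]] by blast
  obtain k w where "pullback C f z k w"
    by (rule pullback_exists[OF finitely_complete assms z(1) z(3)[symmetric]])
  then have "kernel C k f" by (rule pullback_imp_kernel) (use Z z in simp)
  then show ?thesis by blast
qed

text \<open>
  Protomodularity in the form: the kernel and the section of a split epimorphism are jointly
  epimorphic, because the equaliser of two arrows agreeing on both is again a split epimorphism
  with the same kernel.
\<close>

lemma split_epi_jointly_epi:
  assumes ps: "split_by C p s" and k: "kernel C k p"
    and u: "u \<in> Arr C" "Dom C u = Dom C p" and v: "v \<in> Arr C" "Dom C v = Dom C p"
    and uv: "Cod C u = Cod C v" "u \<cdot> s = v \<cdot> s" "u \<cdot> k = v \<cdot> k"
  shows "u = v"
proof -
  have s: "p \<in> Arr C" "s \<in> Arr C" "Dom C s = Cod C p" "Cod C s = Dom C p" "p \<cdot> s = Ident C (Cod C p)"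
    using ps unfolding split_by_def by simp_all
  note K = kernelD[OF k]
  have duv: "Dom C u = Dom C v" using u v by simp
  obtain e where e: "e \<in> Arr C" "Cod C e = Dom C u" "u \<cdot> e = v \<cdot> e"
    and lift: "\<And>x. x \<in> Arr C \<Longrightarrow> Cod C x = Dom C u \<Longrightarrow> u \<cdot> x = v \<cdot> x \<Longrightarrow>
      \<exists>h. h \<in> Arr C \<and> Dom C h = Dom C x \<and> Cod C h = Dom C e \<and> e \<cdot> h = x"
    and cancel: "\<And>x y. x \<in> Arr C \<Longrightarrow> y \<in> Arr C \<Longrightarrow> Dom C x = Dom C y \<Longrightarrow> Cod C x = Dom C e \<Longrightarrow>
      Cod C y = Dom C e \<Longrightarrow> e \<cdot> x = e \<cdot> y \<Longrightarrow> x = y"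
    by (rule equaliser_exists[OF finitely_complete u(1) v(1) duv uv(1) that])
  obtain s' where s': "s' \<in> Arr C" "Dom C s' = Dom C s" "Cod C s' = Dom C e" "e \<cdot> s' = s"
    using lift[of s] s u uv by auto
  obtain k' where k': "k' \<in> Arr C" "Dom C k' = Dom C k" "Cod C k' = Dom C e" "e \<cdot> k' = k"
    using lift[of k] K u uv by auto
  have "split_by C (p \<cdot> e) s'"
    using s e(1,2) s' u unfolding split_by_def by (simp add: assoc)
  moreover have "kernel C k' (p \<cdot> e)"
  proof (rule kernelI)
    show "zero_arr C ((p \<cdot> e) \<cdot> k')" using s K k' e(1,2) u by (simp add: assoc)
  next
    fix x assume x: "x \<in> Arr C" "Cod C x = Dom C (p \<cdot> e)" "zero_arr C ((p \<cdot> e) \<cdot> x)"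
    have x': "Cod C x = Dom C e" using x s e(1,2) u by simp
    have "zero_arr C (p \<cdot> (e \<cdot> x))" using x(1,3) x' s e(1,2) u by (simp add: assoc)
    then obtain y where y: "y \<in> Arr C" "Dom C y = Dom C x" "Cod C y = Dom C k" "k \<cdot> y = e \<cdot> x"
      using kernel_lift[OF k, of "e \<cdot> x"] x(1) x' e(1,2) u by auto
    have "k' \<cdot> y = x"
      by (rule cancel) (use x(1) x' y k' e(1,2) in \<open>simp_all flip: assoc\<close>)
    then show "\<exists>y. y \<in> Arr C \<and> Dom C y = Dom C x \<and> Cod C y = Dom C k' \<and> k' \<cdot> y = x"
      using y k' by auto
  next
    fix x y
    assume x: "x \<in> Arr C" "y \<in> Arr C" "Dom C x = Dom C y" "Cod C x = Dom C k'"
      "Cod C y = Dom C k'" "k' \<cdot> x = k' \<cdot> y"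
    have "(e \<cdot> k') \<cdot> x = (e \<cdot> k') \<cdot> y" using x k'(1-3) e(1,2) by (simp add: assoc)
    then show "x = y" using kernel_cancel[OF k] x k' by simp
  qed (use s e(1,2) u k' in auto)
  ultimately have "iso C e"
    by (rule split_short_five[OF _ _ ps k, of _ _ _ "Ident C (Dom C k)" _ "Ident C (Cod C p)"])
      (use s s' k' K e(1,2) u iso_Ident in auto)
  then obtain j where j: "j \<in> Arr C" "Dom C j = Cod C e" "Cod C j = Dom C e"
    "e \<cdot> j = Ident C (Cod C e)"
    by (rule isoE)
  have "(u \<cdot> e) \<cdot> j = (v \<cdot> e) \<cdot> j" using e by simp
  then show ?thesis using j u v e(1,2) by (simp add: assoc)
qed

text \<open>The first projection \<open>r1\<close> of the kernel pair of \<open>q\<close> is split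
  by the diagonal \<open>s\<close>, and its kernel \<open>n\<close> is the arrow with components
  zero and \<open>k\<close>. If \<open>x\<close> annihilates \<open>k\<close>, then
  \<open>x \<cdot> r1\<close> and \<open>x \<cdot> r2\<close> agree on both \<open>s\<close> and
  \<open>n\<close>, hence are equal by joint epimorphy, and \<open>x\<close> descends along
  \<open>q\<close>.\<close>

lemma regular_epi_imp_normal_epi:
  assumes q: "regular_epi C q"
  shows "normal_epi C q"
proof -
  obtain f g where fg: "coequaliser C q f g" using q unfolding regular_epi_def by blast
  note D = coequaliserD[OF fg]
  obtain k where k: "kernel C k q" using kernel_exists[OF D(5)] by blast
  note K = kernelD[OF k]
  obtain r1 r2 where P: "pullback C q q r1 r2"
    by (rule pullback_exists[OF finitely_complete D(5) D(5) refl])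
  note R = pullbackD[OF P]
  obtain s where s: "s \<in> Arr C" "Dom C s = Dom C q" "Cod C s = Dom C r1"
    "r1 \<cdot> s = Ident C (Dom C q)" "r2 \<cdot> s = Ident C (Dom C q)"
    using pullback_lift[OF P, of "Ident C (Dom C q)" "Ident C (Dom C q)"] D(5) by auto
  obtain Z where Z: "zero_object C Z" using has_zero_object by blast
  obtain z where z: "z \<in> Arr C" "Dom C z = Dom C k" "Cod C z = Dom C q" "zero_arr C z"
    using zero_arr_exists[OF Z Obj_Dom[OF K(2)] Obj_Dom[OF K(1)]] by blast
  \<comment> \<open>\<open>q\<close> sends both \<open>z\<close> and \<open>k\<close> to zero, so
    the pair of \<open>z\<close> and \<open>k\<close> lifts to the kernel pair.\<close>
  have "zero_arr C (q \<cdot> z)" by (rule zero_arr_Comp_left) (use z K in auto)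
  then have "q \<cdot> z = q \<cdot> k" using K(4) by (rule zero_arr_unique) (use z K in auto)
  then obtain n where n: "n \<in> Arr C" "Dom C n = Dom C k" "Cod C n = Dom C r1"
    "r1 \<cdot> n = z" "r2 \<cdot> n = k"
    using pullback_lift[OF P z(1) K(2)] z K by auto
  have split: "split_by C r1 s"
    using s R unfolding split_by_def by simp
  have ker: "kernel C n r1"
  proof (rule kernelI)
    fix x assume x: "x \<in> Arr C" "Cod C x = Dom C r1" "zero_arr C (r1 \<cdot> x)"
    have "(q \<cdot> r1) \<cdot> x = q \<cdot> (r1 \<cdot> x)" "(q \<cdot> r2) \<cdot> x = q \<cdot> (r2 \<cdot> x)"
      using x(1,2) R(1-8) by (simp_all add: assoc)
    then have "zero_arr C (q \<cdot> (r2 \<cdot> x))"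
      using zero_arr_Comp_left[OF x(3), of q] x(1,2) R by simp
    then obtain y where y: "y \<in> Arr C" "Dom C y = Dom C x" "Cod C y = Dom C k" "k \<cdot> y = r2 \<cdot> x"
      using kernel_lift[OF k, of "r2 \<cdot> x"] x(1,2) R by auto
    have "n \<cdot> y = x"
    proof (rule pullback_unique[OF P])
      have "zero_arr C (z \<cdot> y)" by (rule zero_arr_Comp_right) (use z y in auto)
      then show "r1 \<cdot> (n \<cdot> y) = r1 \<cdot> x"
        using x(3) n y z R(1-8) x(1,2)
        by (intro zero_arr_unique) (simp_all flip: assoc)
      have "(r2 \<cdot> n) \<cdot> y = r2 \<cdot> (n \<cdot> y)"
        by (rule assoc) (use n(1-3) y R(1-8) in auto)
      then show "r2 \<cdot> (n \<cdot> y) = r2 \<cdot> x" using n y by simp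
    qed (use x(1,2) y n in auto)
    then show "\<exists>y. y \<in> Arr C \<and> Dom C y = Dom C x \<and> Cod C y = Dom C n \<and> n \<cdot> y = x"
      using y n by auto
  next
    fix x y
    assume x: "x \<in> Arr C" "y \<in> Arr C" "Dom C x = Dom C y" "Cod C x = Dom C n"
      "Cod C y = Dom C n" "n \<cdot> x = n \<cdot> y"
    have "(r2 \<cdot> n) \<cdot> x = (r2 \<cdot> n) \<cdot> y" using x n(1-3) R(1-8) by (simp add: assoc)
    then show "x = y" using kernel_cancel[OF k] x n by simp
  qed (use n z R in auto)
  \<comment> \<open>The pair \<open>f\<close>, \<open>g\<close> coequalised by \<open>q\<close>
    factors through the kernel pair, so an equality on the projections passes to \<open>f\<close>
    and \<open>g\<close>.\<close>
  obtain h where h: "h \<in> Arr C" "Dom C h = Dom C f" "Cod C h = Dom C r1" "r1 \<cdot> h = f" "r2 \<cdot> h = g"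
    using pullback_lift[OF P D(1,2)] D by auto
  have "cokernel C q k"
  proof (rule cokernelI)
    fix x assume x: "x \<in> Arr C" "Dom C x = Cod C k" "zero_arr C (x \<cdot> k)"
    have xq: "Dom C x = Dom C q" using x K by simp
    have "x \<cdot> r1 = x \<cdot> r2"
    proof (rule split_epi_jointly_epi[OF split ker])
      show "(x \<cdot> r1) \<cdot> s = (x \<cdot> r2) \<cdot> s" using x(1) xq R(1-8) s by (simp add: assoc)
      have "zero_arr C (x \<cdot> z)" by (rule zero_arr_Comp_left) (use z x(1) xq in auto)
      then have "x \<cdot> z = x \<cdot> k" using x(3) by (rule zero_arr_unique) (use x(1,2) xq z K in auto)
      then show "(x \<cdot> r1) \<cdot> n = (x \<cdot> r2) \<cdot> n" using x(1) xq R(1-8) n by (simp add: assoc)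
    qed (use x(1) xq R in auto)
    then have "(x \<cdot> r1) \<cdot> h = (x \<cdot> r2) \<cdot> h" by simp
    then have "x \<cdot> f = x \<cdot> g" using x(1) xq R(1-8) h by (simp add: assoc)
    then show "\<exists>y. y \<in> Arr C \<and> Dom C y = Cod C q \<and> Cod C y = Cod C x \<and> y \<cdot> q = x"
      using coequaliser_lift[OF fg x(1)] xq D by simp
  qed (use D K coequaliser_cancel[OF fg] in auto)
  then show ?thesis unfolding normal_epi_def by blast
qed

lemma normal_epi_pullback:
  assumes "pullback C f g p q" "normal_epi C f"
  shows "normal_epi C q"
  using assms regular_epi_stable normal_epi_imp_regular_epi regular_epi_imp_normal_epi
  unfolding pullback_stable_def by blast

end

section \<open>From torsion theories to factorisation systems\<close>

text \<open>The inverse construction: applied to \<open>E\<close> it returns the torsion objects,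
  applied to \<open>M\<close> the torsion-free ones. The zero object is existential since none is
  chosen.\<close>

definition terminal_class :: "('o, 'm) cat \<Rightarrow> 'm set \<Rightarrow> 'o set" where
  "terminal_class C S = {X. \<exists>Z z. zero_object C Z \<and> z \<in> Hom C X Z \<and> z \<in> S}"

section \<open>The barred classes and their orthogonality\<close>

context category
begin

lemma E_barD:
  assumes "e \<in> E_bar C T"
  obtains k where "e \<in> Arr C" "normal_epi C e" "kernel C k e" "Dom C k \<in> T"
  using assms unfolding E_bar_def by blast

lemma E_barI: "normal_epi C e \<Longrightarrow> kernel C k e \<Longrightarrow> Dom C k \<in> T \<Longrightarrow> e \<in> E_bar C T"
  unfolding E_bar_def using normal_epi_Arr by blast

lemma M_barD:
  assumes "m \<in> M_bar C F"
  obtains k where "m \<in> Arr C" "kernel C k m" "Dom C k \<in> F"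
  using assms unfolding M_bar_def by blast

lemma M_barI: "kernel C k m \<Longrightarrow> Dom C k \<in> F \<Longrightarrow> m \<in> M_bar C F"
  unfolding M_bar_def using kernelD(1) by blast

text \<open>The diagonal of the square with an identity on top and \<open>m\<close> below is a
  retraction of \<open>e\<close>; as \<open>e\<close> is epic it is an inverse. Applied to a
  factorisation of an arrow orthogonal to the whole left class.\<close>

lemma orthogonal_imp_left_factor_iso:
  assumes o: "orthogonal C e (m \<cdot> e)" and e: "e \<in> Arr C" "m \<in> Arr C" "Dom C m = Cod C e"
    and epi: "\<And>x y. x \<in> Arr C \<Longrightarrow> y \<in> Arr C \<Longrightarrow> Cod C x = Cod C y \<Longrightarrow> Dom C x = Cod C e \<Longrightarrow>
      Dom C y = Cod C e \<Longrightarrow> x \<cdot> e = y \<cdot> e \<Longrightarrow> x = y"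
  shows "iso C e"
proof -
  obtain d where d: "d \<in> Arr C" "Dom C d = Cod C e" "Cod C d = Dom C e" "d \<cdot> e = Ident C (Dom C e)"
    using orthogonal_lift[OF o, of "Ident C (Dom C e)" m] e by auto
  have "e \<cdot> d = Ident C (Cod C e)"
    by (rule epi) (use d e in \<open>simp_all add: assoc\<close>)
  then show ?thesis using d e by (intro isoI[of e d]) simp_all
qed

text \<open>The dual use: the square with \<open>e\<close> on top and an identity below yields a
  section \<open>d\<close> of \<open>m\<close>, and \<open>d \<cdot> m\<close> is an identity
  because it is one after \<open>e\<close>.\<close>

lemma orthogonal_imp_right_factor_iso:
  assumes o: "orthogonal C (m \<cdot> e) m" and e: "e \<in> Arr C" "m \<in> Arr C" "Dom C m = Cod C e"
    and epi: "\<And>x y. x \<in> Arr C \<Longrightarrow> y \<in> Arr C \<Longrightarrow> Cod C x = Cod C y \<Longrightarrow> Dom C x = Cod C e \<Longrightarrow>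
      Dom C y = Cod C e \<Longrightarrow> x \<cdot> e = y \<cdot> e \<Longrightarrow> x = y"
  shows "iso C m"
proof -
  have "\<exists>d. d \<in> Arr C \<and> Dom C d = Cod C (m \<cdot> e) \<and> Cod C d = Dom C m \<and> d \<cdot> (m \<cdot> e) = e
      \<and> m \<cdot> d = Ident C (Cod C m)"
    by (rule orthogonal_lift[OF o]) (use e in simp_all)
  then obtain d where d: "d \<in> Arr C" "Dom C d = Cod C m" "Cod C d = Dom C m" "d \<cdot> (m \<cdot> e) = e"
    "m \<cdot> d = Ident C (Cod C m)"
    unfolding Comp_simps(3)[OF e(1,2,3)] by blast
  have "d \<cdot> m = Ident C (Dom C m)"
    by (rule epi) (use d e in \<open>simp_all add: assoc\<close>)
  then show ?thesis using d e by (intro isoI[of m d]) simp_all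
qed

text \<open>Such an arrow is the cokernel of the identity of its domain.\<close>

lemma normal_epi_to_zero_object:
  assumes Z: "zero_object C Z" and z: "z \<in> Arr C" "Cod C z = Z"
  shows "normal_epi C z"
proof -
  have zz: "zero_arr C z" using Z z by (rule zero_arr_to_zero_object)
  have "cokernel C z (Ident C (Dom C z))"
  proof (rule cokernelI)
    fix x assume x: "x \<in> Arr C" "Dom C x = Cod C (Ident C (Dom C z))"
      "zero_arr C (x \<cdot> Ident C (Dom C z))"
    obtain y where y: "y \<in> Arr C" "Dom C y = Z" "Cod C y = Cod C x"
      using zero_object_from[OF Z Obj_Cod[OF x(1)]] by blast
    have "zero_arr C (y \<cdot> z)" by (rule zero_arr_Comp_left[OF zz]) (use y z in auto)
    moreover have "zero_arr C x" using x z by simp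
    ultimately have "y \<cdot> z = x" by (rule zero_arr_unique) (use x y z in auto)
    then show "\<exists>y. y \<in> Arr C \<and> Dom C y = Cod C z \<and> Cod C y = Cod C x \<and> y \<cdot> z = x"
      using y z by (intro exI[of _ y]) simp
  next
    fix x y assume "x \<in> Arr C" "y \<in> Arr C" "Cod C x = Cod C y" "Dom C x = Cod C z" "Dom C y = Cod C z"
    then show "x = y" using z by (intro zero_object_from_unique[OF Z]) simp_all
  qed (use z zz in simp_all)
  then show ?thesis unfolding normal_epi_def by blast
qed

text \<open>The top arrow \<open>a\<close> restricts to an arrow \<open>u\<close> from
  \<open>K[e]\<close> to \<open>K[m]\<close>, which is zero by \<open>TF\<close>. Hence
  \<open>a\<close> annihilates \<open>ker e\<close> and descends along \<open>e\<close>, the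
  cokernel of its kernel. \<open>TF\<close> is an explicit hypothesis so that the lemma serves both
  directions of the correspondence.\<close>

lemma torsion_orthogonal:
  assumes TF: "\<And>f. f \<in> Arr C \<Longrightarrow> Dom C f \<in> T \<Longrightarrow> Cod C f \<in> F \<Longrightarrow> zero_arr C f"
    and eE: "e \<in> E_bar C T" and mM: "m \<in> M_bar C F"
  shows "orthogonal C e m"
  unfolding orthogonal_def
proof (intro ballI impI)
  obtain k where k: "e \<in> Arr C" "normal_epi C e" "kernel C k e" "Dom C k \<in> T"
    using eE by (rule E_barD)
  obtain l where l: "m \<in> Arr C" "kernel C l m" "Dom C l \<in> F"
    using mM by (rule M_barD)
  note K = kernelD[OF k(3)] and L = kernelD[OF l(2)]
  have ck: "cokernel C e k" using k(2,3) by (rule normal_epi_cokernel)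
  fix a b assume "a \<in> Hom C (Dom C e) (Dom C m)" "b \<in> Hom C (Cod C e) (Cod C m)"
    and eq: "b \<cdot> e = m \<cdot> a"
  then have a: "a \<in> Arr C" "Dom C a = Dom C e" "Cod C a = Dom C m"
    and b: "b \<in> Arr C" "Dom C b = Cod C e" "Cod C b = Cod C m" by simp_all
  have "(m \<cdot> a) \<cdot> k = m \<cdot> (a \<cdot> k)" "(b \<cdot> e) \<cdot> k = b \<cdot> (e \<cdot> k)"
    using a b K L by (simp_all add: assoc)
  then have "zero_arr C (m \<cdot> (a \<cdot> k))"
    using zero_arr_Comp_left[OF K(4), of b] eq b K by simp
  then obtain u where u: "u \<in> Arr C" "Dom C u = Dom C k" "Cod C u = Dom C l" "l \<cdot> u = a \<cdot> k"
    using kernel_lift[OF l(2), of "a \<cdot> k"] a K L by auto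
  have "zero_arr C u" by (rule TF) (use u k l in auto)
  then have "zero_arr C (a \<cdot> k)" using zero_arr_Comp_left[of u l] u L by simp
  then obtain d where d: "d \<in> Arr C" "Dom C d = Cod C e" "Cod C d = Cod C a" "d \<cdot> e = a"
    using cokernel_lift[OF ck a(1)] a K by auto
  show "\<exists>!d. d \<in> Hom C (Cod C e) (Dom C m) \<and> d \<cdot> e = a \<and> m \<cdot> d = b"
  proof (rule ex1I)
    have "m \<cdot> d = b"
      by (rule normal_epi_cancel[OF k(2)]) (use d a b k(1) l(1) eq in \<open>simp_all add: assoc\<close>)
    then show "d \<in> Hom C (Cod C e) (Dom C m) \<and> d \<cdot> e = a \<and> m \<cdot> d = b"
      using d a by simp
  next
    fix d' assume "d' \<in> Hom C (Cod C e) (Dom C m) \<and> d' \<cdot> e = a \<and> m \<cdot> d' = b"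
    then have d': "d' \<in> Arr C" "Dom C d' = Cod C e" "Cod C d' = Dom C m" "d' \<cdot> e = a" by simp_all
    show "d' = d"
      by (rule normal_epi_cancel[OF k(2)]) (use d d' a in simp_all)
  qed
qed

lemma replete_iso: "replete C S \<Longrightarrow> iso C f \<Longrightarrow> Dom C f \<in> S \<Longrightarrow> Cod C f \<in> S"
  unfolding replete_def by blast

end

lemma (in torsion_theory) zero_arr_T_F:
  assumes "f \<in> Arr C" "Dom C f \<in> T" "Cod C f \<in> F"
  shows "zero_arr C f"
proof -
  have "f \<in> Hom C (Dom C f) (Cod C f)" using assms by simp
  then show ?thesis using Hom_T_F[OF assms(2,3)] by blast
qed

section \<open>Torsion theories in a homological category\<close>

locale homological_torsion_theory = homological_category + torsion_theory
begin

text \<open>The identity of \<open>X\<close> is a kernel of \<open>X \<rightarrow> 0\<close>, which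
  is moreover a normal epimorphism, so the condition on kernels reduces to a condition on
  \<open>X\<close>.\<close>

lemma torsion_theory_determined:
  shows "T = terminal_class C (E_bar C T)" and "F = terminal_class C (M_bar C F)"
proof -
  have Obj: "X \<in> Obj C" if "X \<in> T \<or> X \<in> F" for X
    using that replete_T replete_F unfolding replete_def by blast
  have kernel: "\<exists>Z z. zero_object C Z \<and> z \<in> Hom C X Z \<and> kernel C (Ident C X) z" if "X \<in> Obj C" for X
  proof -
    obtain Z where Z: "zero_object C Z" using has_zero_object by blast
    obtain z where z: "z \<in> Arr C" "Dom C z = X" "Cod C z = Z" "zero_arr C z"
      using zero_object_to[OF Z \<open>X \<in> Obj C\<close>] by blast
    then have "kernel C (Ident C X) z" using kernel_Ident_of_zero_arr by blast
    then show ?thesis using Z z by auto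
  qed
  \<comment> \<open>The kernel witnessing membership in a barred class need not be the identity, but
    it is an isomorphism, and repleteness transports membership along it.\<close>
  have Dom_in: "Dom C z \<in> S"
    if "replete C S" "zero_object C (Cod C z)" "kernel C k z" "Dom C k \<in> S" for S z k
  proof -
    have "zero_arr C z" using that kernelD zero_arr_to_zero_object by blast
    then have "iso C k" using that kernel_iso_of_zero_arr by blast
    then have "Cod C k \<in> S" using that replete_iso by blast
    then show ?thesis using that kernelD(3)[of k z] by simp
  qed
  show "T = terminal_class C (E_bar C T)"
  proof (intro equalityI subsetI)
    fix X assume X: "X \<in> T"
    then obtain Z z where z: "zero_object C Z" "z \<in> Hom C X Z" "kernel C (Ident C X) z"
      using kernel Obj by blast
    then have "z \<in> E_bar C T"
      using X Obj by (intro E_barI[of z "Ident C X"] normal_epi_to_zero_object[OF z(1)]) simp_all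
    then show "X \<in> terminal_class C (E_bar C T)"
      using z unfolding terminal_class_def by blast
  next
    fix X assume "X \<in> terminal_class C (E_bar C T)"
    then obtain Z z where z: "zero_object C Z" "z \<in> Hom C X Z" "z \<in> E_bar C T"
      unfolding terminal_class_def by blast
    obtain k where "kernel C k z" "Dom C k \<in> T" using z(3) by (rule E_barD)
    then show "X \<in> T" using Dom_in[OF replete_T, of z k] z by simp
  qed
  show "F = terminal_class C (M_bar C F)"
  proof (intro equalityI subsetI)
    fix X assume X: "X \<in> F"
    then obtain Z z where z: "zero_object C Z" "z \<in> Hom C X Z" "kernel C (Ident C X) z"
      using kernel Obj by blast
    then have "z \<in> M_bar C F"
      using X Obj by (intro M_barI[of "Ident C X"]) simp_all
    then show "X \<in> terminal_class C (M_bar C F)"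
      using z unfolding terminal_class_def by blast
  next
    fix X assume "X \<in> terminal_class C (M_bar C F)"
    then obtain Z z where z: "zero_object C Z" "z \<in> Hom C X Z" "z \<in> M_bar C F"
      unfolding terminal_class_def by blast
    obtain k where "kernel C k z" "Dom C k \<in> F" using z(3) by (rule M_barD)
    then show "X \<in> F" using Dom_in[OF replete_F, of z k] z by simp
  qed
qed

text \<open>
  The first factor divides out the torsion part \<open>T(K[f])\<close> of the kernel, which is normal in the
  domain of \<open>f\<close> by condition (N); the kernel of the second factor is then \<open>F(K[f])\<close>.
\<close>

lemma bar_factorisation:
  assumes N: "condition_N C T F" and f: "f \<in> Arr C"
  obtains e m where "e \<in> E_bar C T" "m \<in> M_bar C F" "Cod C e = Dom C m" "f = m \<cdot> e"
proof -
  obtain k where k: "kernel C k f" using kernel_exists[OF f] by blast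
  note K = kernelD[OF k]
  obtain t \<eta> where t\<eta>: "torsion_sequence C T F t \<eta>" and ct: "Cod C t = Dom C k"
    using has_torsion_sequence[OF Obj_Dom[OF K(2)]] by blast
  have t: "kernel C t \<eta>" "cokernel C \<eta> t" "Dom C t \<in> T" "Cod C \<eta> \<in> F"
    using t\<eta> unfolding torsion_sequence_def short_exact_def by simp_all
  note Tt = kernelD[OF t(1)]
  have "normal_mono C (k \<cdot> t)" using N k t\<eta> ct unfolding condition_N_def by blast
  then obtain g where g: "kernel C (k \<cdot> t) g" unfolding normal_mono_def by blast
  \<comment> \<open>(N) provides only some \<open>g\<close> with the required kernel. The regular
    epimorphism in its image factorisation keeps that kernel and is normal, hence is the quotient by
    \<open>k \<cdot> t\<close>.\<close>
  obtain e m0 where em: "regular_epi C e" "mono_arr C m0" "Cod C e = Dom C m0" "g = m0 \<cdot> e"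
    using image_factorisation[OF kernelD(1)[OF g]] by blast
  have e: "normal_epi C e" "e \<in> Arr C"
    using em(1) regular_epi_imp_normal_epi regular_epi_Arr by blast+
  have ke: "kernel C (k \<cdot> t) e"
    using em(2) em(3)[symmetric] g[unfolded em(4)] e(2) by (rule kernel_Comp_mono)
  note KE = kernelD[OF ke]
  have ce: "cokernel C e (k \<cdot> t)" using e(1) ke by (rule normal_epi_cokernel)
  have "zero_arr C ((f \<cdot> k) \<cdot> t)" by (rule zero_arr_Comp_right[OF K(4)]) (use Tt K ct in auto)
  then have "zero_arr C (f \<cdot> (k \<cdot> t))" using Tt K ct by (simp add: assoc)
  then obtain m where m: "m \<in> Arr C" "Dom C m = Cod C e" "Cod C m = Cod C f" "m \<cdot> e = f"
    using cokernel_lift[OF ce f] K Tt ct by auto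
  obtain l where l: "kernel C l m" using kernel_exists[OF m(1)] by blast
  note L = kernelD[OF l]
  obtain e' where P: "pullback C e l k e'"
    by (rule pullback_of_kernels[OF k[folded m(4)] l e(2) m(2)])
  note PD = pullbackD[OF P]
  have "normal_epi C e'" using P e(1) by (rule normal_epi_pullback)
  moreover have "kernel C t e'"
    by (rule kernel_through_pullback[OF P l ke _ ct k]) (use Tt in simp)
  ultimately have "cokernel C e' t" by (rule normal_epi_cokernel)
  \<comment> \<open>\<open>\<eta>\<close> and \<open>e'\<close> are both cokernels of
    \<open>t\<close>, so their codomains are isomorphic.\<close>
  then obtain i where "iso C i" "Dom C i = Cod C \<eta>" "Cod C i = Cod C e'"
    by (rule cokernels_iso[OF t(2)])
  then have "Dom C l \<in> F" using replete_iso[OF replete_F, of i] t(4) PD by simp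
  then have "m \<in> M_bar C F" by (rule M_barI[OF l])
  moreover have "e \<in> E_bar C T"
    by (rule E_barI[OF e(1) ke]) (use t(3) K Tt ct in simp)
  ultimately show thesis using that m by simp
qed

text \<open>Orthogonality gives one inclusion of each closure equation. For the other, factorise the
  given arrow: orthogonality makes the unwanted factor invertible, and the barred classes absorb
  isomorphisms. Stability combines stability of normal epimorphisms with invariance of the kernel
  object under pullback.\<close>

lemma bar_stable_factorisation_system:
  assumes N: "condition_N C T F"
  shows "stable_factorisation_system C (E_bar C T) (M_bar C F)"
proof unfold_locales
  have orth: "orthogonal C e m" if "e \<in> E_bar C T" "m \<in> M_bar C F" for e m
    using zero_arr_T_F that by (rule torsion_orthogonal)
  show "M_bar C F = {m \<in> Arr C. \<forall>e \<in> E_bar C T. orthogonal C e m}"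
  proof (intro equalityI subsetI)
    fix m assume "m \<in> {m \<in> Arr C. \<forall>e \<in> E_bar C T. orthogonal C e m}"
    then have m: "m \<in> Arr C" "\<And>e. e \<in> E_bar C T \<Longrightarrow> orthogonal C e m" by simp_all
    obtain e n where en: "e \<in> E_bar C T" "n \<in> M_bar C F" "Cod C e = Dom C n" "m = n \<cdot> e"
      using bar_factorisation[OF N m(1)] .
    have e: "e \<in> Arr C" "normal_epi C e" using en(1) unfolding E_bar_def by simp_all
    obtain l where l: "n \<in> Arr C" "kernel C l n" "Dom C l \<in> F" using en(2) by (rule M_barD)
    have "iso C e"
      by (rule orthogonal_imp_left_factor_iso[of e n])
        (use m(2)[OF en(1)] en(3,4) e l(1) normal_epi_cancel[OF e(2)] in auto)
    then obtain k where "kernel C k m" "Dom C k = Dom C l"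
      using kernel_of_Comp_iso[OF l(2), of e] en(3,4) by auto
    then show "m \<in> M_bar C F" using M_barI l(3) by simp
  qed (use orth M_barD in auto)
  show "E_bar C T = {e \<in> Arr C. \<forall>m \<in> M_bar C F. orthogonal C e m}"
  proof (intro equalityI subsetI)
    fix e assume "e \<in> {e \<in> Arr C. \<forall>m \<in> M_bar C F. orthogonal C e m}"
    then have e: "e \<in> Arr C" "\<And>m. m \<in> M_bar C F \<Longrightarrow> orthogonal C e m" by simp_all
    obtain q m where qm: "q \<in> E_bar C T" "m \<in> M_bar C F" "Cod C q = Dom C m" "e = m \<cdot> q"
      using bar_factorisation[OF N e(1)] .
    obtain k where k: "q \<in> Arr C" "normal_epi C q" "kernel C k q" "Dom C k \<in> T"
      using qm(1) by (rule E_barD)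
    have m: "m \<in> Arr C" using qm(2) by (rule M_barD)
    have i: "iso C m"
      by (rule orthogonal_imp_right_factor_iso[of m q])
        (use e(2)[OF qm(2)] qm(3,4) m k(1) normal_epi_cancel[OF k(2)] in auto)
    show "e \<in> E_bar C T"
      unfolding qm(4)
    proof (rule E_barI)
      show "normal_epi C (m \<cdot> q)"
        using k(2) cokernel_iso_Comp[OF _ i qm(3)[symmetric]] unfolding normal_epi_def by blast
      show "kernel C k (m \<cdot> q)" using k(3) i qm(3)[symmetric] by (rule kernel_iso_Comp)
    qed (rule k(4))
  qed (use orth E_barD in auto)
  show "\<exists>e \<in> E_bar C T. \<exists>m \<in> M_bar C F. Cod C e = Dom C m \<and> f = m \<cdot> e" if "f \<in> Arr C" for f
    using bar_factorisation[OF N that] by metis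
  show "pullback_stable C (E_bar C T)"
    unfolding pullback_stable_def
  proof (intro allI impI)
    fix f g p q assume *: "pullback C f g p q \<and> f \<in> E_bar C T"
    obtain k where k: "normal_epi C f" "kernel C k f" "Dom C k \<in> T"
      using * E_barD by blast
    obtain k' where "kernel C k' q" "Dom C k' = Dom C k"
      using kernel_of_pullback * k(2) by blast
    then show "q \<in> E_bar C T"
      using * k normal_epi_pullback[of f g p q] by (intro E_barI[of q k']) auto
  qed
qed

end

section \<open>From factorisation systems to torsion theories\<close>

locale normal_epi_factorisation_system = homological_category + stable_factorisation_system +
  assumes normal_epi_E: "e \<in> E \<Longrightarrow> normal_epi C e"
begin

lemma E_Arr: "e \<in> E \<Longrightarrow> e \<in> Arr C"
  using E_eq by blast

lemma M_Arr: "m \<in> M \<Longrightarrow> m \<in> Arr C"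
  using M_eq by blast

lemma E_M_orthogonal: "e \<in> E \<Longrightarrow> m \<in> M \<Longrightarrow> orthogonal C e m"
  using E_eq by blast

text \<open>A class defined by right orthogonality inherits pullbacks, so kernels of arrows in
  \<open>M\<close> can be treated like those of arrows in \<open>E\<close>.\<close>

lemma M_stable: "pullback_stable C M"
  unfolding pullback_stable_def
proof (intro allI impI)
  fix m g p q assume *: "pullback C m g p q \<and> m \<in> M"
  then have "orthogonal C e q" if "e \<in> E" for e
    using that E_M_orthogonal E_Arr orthogonal_pullback by blast
  then show "q \<in> M" using * pullbackD(5) M_eq by blast
qed

text \<open>\<open>K[f] \<rightarrow> 0\<close> is a pullback of \<open>f\<close>. The class
  \<open>S\<close> is left arbitrary to cover both \<open>E\<close> and \<open>M\<close>.\<close>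

lemma kernel_Dom_terminal_class:
  assumes S: "pullback_stable C S" and f: "f \<in> S" and k: "kernel C k f"
  shows "Dom C k \<in> terminal_class C S"
proof -
  note D = kernelD[OF k]
  obtain Z where Z: "zero_object C Z" using has_zero_object by blast
  obtain z where z: "z \<in> Arr C" "Dom C z = Z" "Cod C z = Cod C f"
    using zero_object_from[OF Z Obj_Cod[OF D(1)]] by blast
  obtain w where w: "w \<in> Arr C" "Dom C w = Dom C k" "Cod C w = Z"
    using zero_object_to[OF Z Obj_Dom[OF D(2)]] by blast
  have "w \<in> S"
    using kernel_imp_pullback[OF k Z z w] S f unfolding pullback_stable_def by blast
  then show ?thesis using w Z unfolding terminal_class_def by auto
qed

lemma replete_terminal_class:
  assumes S: "pullback_stable C S"
  shows "replete C (terminal_class C S)"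
  unfolding replete_def
proof (intro conjI allI impI subsetI)
  fix X assume "X \<in> terminal_class C S"
  then obtain z where "z \<in> Arr C" "Dom C z = X" unfolding terminal_class_def by auto
  then show "X \<in> Obj C" by auto
next
  fix f assume f: "iso C f \<and> Dom C f \<in> terminal_class C S"
  then obtain Z z where z: "zero_object C Z" "z \<in> Arr C" "Dom C z = Dom C f" "Cod C z = Z" "z \<in> S"
    unfolding terminal_class_def by auto
  obtain g where g: "iso C g" "Dom C g = Cod C f" "Cod C g = Dom C f"
    using f iso_inverse by blast
  then have gA: "g \<in> Arr C" unfolding iso_def by blast
  have "pullback C z (Ident C (Cod C z)) g (z \<cdot> g)"
    by (rule pullback_of_iso) (use z g in auto)
  then have "z \<cdot> g \<in> S" using S z(5) unfolding pullback_stable_def by blast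
  moreover have "z \<cdot> g \<in> Hom C (Cod C f) Z" using z g gA by simp
  ultimately show "Cod C f \<in> terminal_class C S"
    using z(1) unfolding terminal_class_def by blast
qed

abbreviation torsion_class where "torsion_class \<equiv> terminal_class C E"
abbreviation torsion_free_class where "torsion_free_class \<equiv> terminal_class C M"

text \<open>The arrow \<open>f\<close> is the top of a square between \<open>z\<close> in
  \<open>E\<close> and \<open>w\<close> in \<open>M\<close> over zero objects; the diagonal factors
  \<open>f\<close> through a zero object.\<close>

lemma zero_arr_torsion:
  assumes f: "f \<in> Arr C" "Dom C f \<in> torsion_class" "Cod C f \<in> torsion_free_class"
  shows "zero_arr C f"
proof -
  obtain Z z where z: "zero_object C Z" "z \<in> Arr C" "Dom C z = Dom C f" "Cod C z = Z" "z \<in> E"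
    using f(2) unfolding terminal_class_def by auto
  obtain W w where w: "zero_object C W" "w \<in> Arr C" "Dom C w = Cod C f" "Cod C w = W" "w \<in> M"
    using f(3) unfolding terminal_class_def by auto
  have "W \<in> Obj C" using w by auto
  then obtain b where b: "b \<in> Arr C" "Dom C b = Z" "Cod C b = W"
    using zero_object_from[OF z(1)] by blast
  have "b \<cdot> z = w \<cdot> f" by (rule zero_object_to_unique[OF w(1)]) (use b z w f in auto)
  then obtain d where d: "d \<in> Arr C" "Dom C d = Z" "d \<cdot> z = f"
    using orthogonal_lift[OF E_M_orthogonal[OF z(5) w(5)] f(1) b(1)] z w b by auto
  then show ?thesis using zero_arrI[OF z(1,2) d(1) z(4) d(2)] by simp
qed

lemma short_exact_kernel_E:
  assumes "e \<in> E" "kernel C k e"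
  shows "short_exact C k e"
  using assms normal_epi_E normal_epi_cokernel unfolding short_exact_def by blast

text \<open>Factorise \<open>A \<rightarrow> 0\<close> as \<open>m \<cdot> e\<close>. Then
  \<open>m\<close> itself shows that the codomain of \<open>e\<close> is torsion-free, stability of
  \<open>E\<close> makes the kernel of \<open>e\<close> torsion, and exactness holds because
  \<open>e\<close> is a normal epimorphism.\<close>

lemma torsion_theory_terminal_class: "torsion_theory C torsion_class torsion_free_class"
proof unfold_locales
  show "replete C torsion_class" using E_stable by (rule replete_terminal_class)
  show "replete C torsion_free_class" using M_stable by (rule replete_terminal_class)
  show "Hom C X Y = {z. zero_arr C z \<and> Dom C z = X \<and> Cod C z = Y}"
    if "X \<in> torsion_class" "Y \<in> torsion_free_class" for X Y
    using that zero_arr_torsion zero_arr_Arr by auto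
  show "\<exists>t \<eta>. torsion_sequence C torsion_class torsion_free_class t \<eta> \<and> Cod C t = A"
    if A: "A \<in> Obj C" for A
  proof -
    obtain Z where Z: "zero_object C Z" using has_zero_object by blast
    obtain z where z: "z \<in> Arr C" "Dom C z = A" "Cod C z = Z"
      using zero_object_to[OF Z A] by blast
    obtain e m where em: "e \<in> E" "m \<in> M" "Cod C e = Dom C m" "z = m \<cdot> e"
      using factorisation[OF z(1)] by blast
    have eA: "e \<in> Arr C" "m \<in> Arr C" using em E_Arr M_Arr by blast+
    obtain k where k: "kernel C k e" using kernel_exists eA by blast
    have "m \<in> Hom C (Cod C e) Z" using em eA z by simp
    then have "Cod C e \<in> torsion_free_class" using Z em unfolding terminal_class_def by blast
    then have "torsion_sequence C torsion_class torsion_free_class k e"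
      using short_exact_kernel_E[OF em(1) k] kernel_Dom_terminal_class[OF E_stable em(1) k]
      unfolding torsion_sequence_def by blast
    moreover have "Cod C k = A" using kernelD[OF k] em eA z by simp
    ultimately show ?thesis by blast
  qed
qed

text \<open>The kernel \<open>n\<close> of \<open>e\<close> lies inside the kernel of
  \<open>f\<close> as \<open>k \<cdot> n'\<close>, where \<open>n'\<close> is a kernel of
  \<open>e'\<close> with torsion domain while \<open>e'\<close> has torsion-free codomain. So
  \<open>n'\<close> and \<open>t\<close> are the same subobject, and \<open>k \<cdot> t\<close> is
  again a kernel of \<open>e\<close>.\<close>

lemma condition_N_terminal_class: "condition_N C torsion_class torsion_free_class"
  unfolding condition_N_def
proof (intro allI impI)
  fix f k t \<eta>
  assume *: "kernel C k f \<and> torsion_sequence C torsion_class torsion_free_class t \<eta> \<and>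
    Cod C t = Dom C k"
  then have k: "kernel C k f" and ct: "Cod C t = Dom C k" by simp_all
  have t: "kernel C t \<eta>" "Dom C t \<in> torsion_class" "Cod C \<eta> \<in> torsion_free_class"
    using * unfolding torsion_sequence_def short_exact_def by simp_all
  note K = kernelD[OF k] and Tt = kernelD[OF t(1)]
  obtain e m where em: "e \<in> E" "m \<in> M" "Cod C e = Dom C m" "f = m \<cdot> e"
    using factorisation[OF K(1)] by blast
  have eA: "e \<in> Arr C" "m \<in> Arr C" using em E_Arr M_Arr by blast+
  obtain n where n: "kernel C n e" using kernel_exists eA by blast
  obtain l where l: "kernel C l m" using kernel_exists eA by blast
  note N = kernelD[OF n] and L = kernelD[OF l]
  have "zero_arr C (f \<cdot> n)"
    using zero_arr_Comp_left[OF N(4), of m] eA em N by (simp add: assoc)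
  then obtain n' where n': "n' \<in> Arr C" "Dom C n' = Dom C n" "Cod C n' = Dom C k" "k \<cdot> n' = n"
    using kernel_lift[OF k, of n] N em eA by auto
  obtain e' where P: "pullback C e l k e'"
    by (rule pullback_of_kernels[OF k[unfolded em(4)] l eA(1) em(3)[symmetric]])
  note PD = pullbackD[OF P]
  have ke': "kernel C n' e'"
    by (rule kernel_through_pullback[OF P l _ n'(1) n'(3) k]) (use n n' in simp)
  have Dn: "Dom C n' \<in> torsion_class"
    using kernel_Dom_terminal_class[OF E_stable em(1) n] n' by simp
  have Dl: "Cod C e' \<in> torsion_free_class"
    using kernel_Dom_terminal_class[OF M_stable em(2) l] PD by simp
  \<comment> \<open>Both composites run from a torsion to a torsion-free object; their vanishing is
    all that the comparison of the two kernels requires.\<close>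
  have z1: "zero_arr C (e' \<cdot> t)" by (rule zero_arr_torsion) (use Tt t(2) ct PD Dl in simp_all)
  have z2: "zero_arr C (\<eta> \<cdot> n')" by (rule zero_arr_torsion) (use Tt t(3) ct n' Dn in simp_all)
  have "Dom C \<eta> = Dom C e'" using Tt ct PD by simp
  then obtain i where i: "iso C i" "Dom C i = Dom C t" "Cod C i = Dom C n'" "n' \<cdot> i = t"
    by (rule kernels_iso[OF t(1) ke' _ z1 z2])
  have iA: "i \<in> Arr C" using i(1) unfolding iso_def by blast
  have "kernel C (n \<cdot> i) e" using n i(1) by (rule kernel_Comp_iso) (use i n' in simp)
  moreover have "(k \<cdot> n') \<cdot> i = k \<cdot> (n' \<cdot> i)" by (rule assoc) (use K n' i iA in auto)
  ultimately have "kernel C (k \<cdot> t) e" using n' i by simp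
  then show "normal_mono C (k \<cdot> t)" unfolding normal_mono_def by blast
qed

lemma M_bar_subset: "M \<subseteq> M_bar C torsion_free_class"
  using kernel_exists kernel_Dom_terminal_class[OF M_stable] M_Arr M_barI by blast

lemma E_bar_subset: "E \<subseteq> E_bar C torsion_class"
  using kernel_exists kernel_Dom_terminal_class[OF E_stable] E_Arr E_barI normal_epi_E by blast

text \<open>Arrows in the barred left class are orthogonal to the barred right class, which contains
  \<open>M\<close>; but \<open>E\<close> consists of all arrows orthogonal to
  \<open>M\<close>.\<close>

lemma E_bar_terminal_class: "E_bar C torsion_class = E"
proof
  show "E_bar C torsion_class \<subseteq> E"
  proof
    fix e assume e: "e \<in> E_bar C torsion_class"
    then have "orthogonal C e m" if "m \<in> M" for m
      using torsion_orthogonal[OF zero_arr_torsion] that M_bar_subset by blast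
    moreover have "e \<in> Arr C" using e by (rule E_barD)
    ultimately show "e \<in> E" using E_eq by blast
  qed
qed (rule E_bar_subset)

lemma M_bar_terminal_class: "M_bar C torsion_free_class = M"
proof
  show "M_bar C torsion_free_class \<subseteq> M"
  proof
    fix m assume m: "m \<in> M_bar C torsion_free_class"
    then have "orthogonal C e m" if "e \<in> E" for e
      using torsion_orthogonal[OF zero_arr_torsion] that E_bar_subset by blast
    moreover have "m \<in> Arr C" using m by (rule M_barD)
    ultimately show "m \<in> M" using M_eq by blast
  qed
qed (rule M_bar_subset)

end

section \<open>The bijective correspondence\<close>

theorem proposition3p5:
  fixes C :: "('o, 'm) cat"
  assumes "homological_category C"
  shows
    "(\<forall>T F. torsion_theory C T F \<and> condition_N C T F \<longrightarrow>
        stable_factorisation_system C (E_bar C T) (M_bar C F) \<and>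
        (\<forall>T' F'. torsion_theory C T' F' \<and> condition_N C T' F' \<and>
           E_bar C T' = E_bar C T \<and> M_bar C F' = M_bar C F \<longrightarrow> T' = T \<and> F' = F)) \<and>
     bij_betw (\<lambda>(T, F). (E_bar C T, M_bar C F))
       {(T, F). torsion_theory C T F \<and> condition_N C T F}
       {(E, M). stable_factorisation_system C E M \<and> (\<forall>e \<in> E. normal_epi C e)}"
proof -
  have TF: "stable_factorisation_system C (E_bar C T) (M_bar C F)"
    "\<forall>e \<in> E_bar C T. normal_epi C e"
    "T = terminal_class C (E_bar C T)" "F = terminal_class C (M_bar C F)"
    if "torsion_theory C T F" "condition_N C T F" for T F
  proof -
    interpret homological_torsion_theory C T F
      using assms that(1) by (rule homological_torsion_theory.intro)
    show "stable_factorisation_system C (E_bar C T) (M_bar C F)"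
      using that(2) by (rule bar_stable_factorisation_system)
    show "T = terminal_class C (E_bar C T)" "F = terminal_class C (M_bar C F)"
      by (rule torsion_theory_determined)+
  qed (simp add: E_bar_def)
  have EM: "\<exists>T F. torsion_theory C T F \<and> condition_N C T F \<and> E = E_bar C T \<and> M = M_bar C F"
    if "stable_factorisation_system C E M" "\<forall>e \<in> E. normal_epi C e" for E M
  proof -
    interpret normal_epi_factorisation_system C E M
      using assms that
      by (intro normal_epi_factorisation_system.intro normal_epi_factorisation_system_axioms.intro) auto
    show ?thesis
      using torsion_theory_terminal_class condition_N_terminal_class E_bar_terminal_class
        M_bar_terminal_class by metis
  qed
  \<comment> \<open>Both pairs arise by \<open>terminal_class\<close> from the same barred
    classes.\<close>
  have unique: "T' = T \<and> F' = F"
    if "torsion_theory C T F" "condition_N C T F" "torsion_theory C T' F'" "condition_N C T' F'"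
      "E_bar C T' = E_bar C T" "M_bar C F' = M_bar C F" for T F T' F'
    using TF(3,4)[OF that(1,2)] TF(3,4)[OF that(3,4)] that(5,6) by simp
  show ?thesis
  proof (intro conjI allI impI)
    fix T F assume "torsion_theory C T F \<and> condition_N C T F"
    then show "stable_factorisation_system C (E_bar C T) (M_bar C F)" using TF(1) by blast
  next
    fix T F T' F'
    assume "torsion_theory C T F \<and> condition_N C T F"
      and "torsion_theory C T' F' \<and> condition_N C T' F' \<and>
        E_bar C T' = E_bar C T \<and> M_bar C F' = M_bar C F"
    then show "T' = T" "F' = F" using unique by blast+
  next
    show "bij_betw (\<lambda>(T, F). (E_bar C T, M_bar C F))
       {(T, F). torsion_theory C T F \<and> condition_N C T F}
       {(E, M). stable_factorisation_system C E M \<and> (\<forall>e \<in> E. normal_epi C e)}"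
      unfolding bij_betw_def
    proof
      show "inj_on (\<lambda>(T, F). (E_bar C T, M_bar C F))
          {(T, F). torsion_theory C T F \<and> condition_N C T F}"
      proof (rule inj_onI)
        fix p q
        assume *: "p \<in> {(T, F). torsion_theory C T F \<and> condition_N C T F}"
          "q \<in> {(T, F). torsion_theory C T F \<and> condition_N C T F}"
          "(\<lambda>(T, F). (E_bar C T, M_bar C F)) p = (\<lambda>(T, F). (E_bar C T, M_bar C F)) q"
        obtain T F T' F' where "p = (T, F)" "q = (T', F')" by (metis surj_pair)
        then show "p = q" using * unique[of T' F' T F] by simp
      qed
      show "(\<lambda>(T, F). (E_bar C T, M_bar C F)) ` {(T, F). torsion_theory C T F \<and> condition_N C T F}
          = {(E, M). stable_factorisation_system C E M \<and> (\<forall>e \<in> E. normal_epi C e)}"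
      proof (intro equalityI subsetI)
        fix p assume "p \<in> {(E, M). stable_factorisation_system C E M \<and> (\<forall>e \<in> E. normal_epi C e)}"
        then obtain T F where "torsion_theory C T F" "condition_N C T F"
          "p = (E_bar C T, M_bar C F)"
          using EM by blast
        then show "p \<in> (\<lambda>(T, F). (E_bar C T, M_bar C F)) `
            {(T, F). torsion_theory C T F \<and> condition_N C T F}"
          by (intro image_eqI[of _ _ "(T, F)"]) simp_all
      qed (use TF(1,2) in auto)
    qed
  qed
qed

end
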